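(* Let $(\boldsymbol{\alpha},\boldsymbol{\beta})\in\mathcal{LW}$ be a non-renormalisable pair such that $(\Sigma_{(\boldsymbol{\alpha},\boldsymbol{\beta})},\sigma_{(\boldsymbol{\alpha},\boldsymbol{\beta})})$ is a coded system, and let $\{(\boldsymbol{\alpha}_n,\boldsymbol{\beta}_n)\}_{n=1}^\infty$ be an approximating sequence of essential pairs for $(\boldsymbol{\alpha},\boldsymbol{\beta})$ (as constructed in the context). If there exists a subsequence $\{(\boldsymbol{\alpha}_{n_k},\boldsymbol{\beta}_{n_k})\}_{k=1}^\infty$ such that for every $k\in\mathbb N$, $$\ell({p_1}_{(\boldsymbol{\alpha}_{n_k},\boldsymbol{\beta}_{n_k})}{p_2}_{(\boldsymbol{\alpha}_{n_k},\boldsymbol{\beta}_{n_k})})<\ell({p_1}_{(\boldsymbol{\alpha}_{n_{k+1}},\boldsymbol{\beta}_{n_{k+1}})}{p_2}_{(\boldsymbol{\alpha}_{n_{k+1}},\boldsymbol{\beta}_{n_{k+1}})})$$ and $$\ell({p_1}_{(\boldsymbol{\alpha}_{n_k},\boldsymbol{\beta}_{n_k})}{p_2}_{(\boldsymbol{\alpha}_{n_k},\boldsymbol{\beta}_{n_k})})\le s_{(\boldsymbol{\alpha}_{n_{k+1}},\boldsymbol{\beta}_{n_{k+1}})},$$ then $(\Sigma_{(\boldsymbol{\alpha},\boldsymbol{\beta})},\sigma_{(\boldsymbol{\alpha},\boldsymbol{\beta})})$ does not have the specification property.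
   Context: **Basics.** $\mathbb N=\{1,2,\dots\}$, $\Sigma_2=\{0,1\}^{\mathbb N}$, $\sigma$ is the one-sided shift, $\prec,\preccurlyeq$ the lexicographic order. $\Sigma_2^1$ (resp. $\Sigma_2^0$) is the set of sequences with first digit $1$ (resp. $0$). For $(\boldsymbol{\alpha},\boldsymbol{\beta})\in\Sigma_2^1\times\Sigma_2^0$, $\Sigma_{(\boldsymbol{\alpha},\boldsymbol{\beta})}=\{\boldsymbol{x}\in\Sigma_2 : \boldsymbol{\beta}\preccurlyeq\sigma^n(\boldsymbol{x})\preccurlyeq\boldsymbol{\alpha}\ \forall n\ge0\}$ and $\sigma_{(\boldsymbol{\alpha},\boldsymbol{\beta})}$ is the restriction of $\sigma$. $P=\{\boldsymbol{\alpha}\in\Sigma_2^1 : \sigma^n(\boldsymbol{\alpha})\preccurlyeq\boldsymbol{\alpha}\ \forall n\in\mathbb N\}$; with $\bar{\boldsymbol{x}}=(1-x_i)_{i\ge1}$, $\bar P=\{\boldsymbol{x}\in\Sigma_2^0:\bar{\boldsymbol{x}}\in P\}$. $\mathcal{LW}$ is the set of $(\boldsymbol{\alpha},\boldsymbol{\beta})\in P\times\bar P$ with $\sigma^n(\boldsymbol{\alpha})\succcurlyeq\boldsymbol{\beta}$ and $\sigma^n(\boldsymbol{\beta})\preccurlyeq\boldsymbol{\alpha}$ for every $n\in\mathbb N$. Words are finite sequences over $\{0,1\}$, $\ell(\omega)$ is the length. $0\text{-}\max_\omega$ is the lexicographically largest cyclic permutation of $\omega$ beginning with $0$; $1\text{-}\min_\omega$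 the lexicographically smallest one beginning with $1$. $1_{\boldsymbol{\alpha}}$ (resp. $0_{\boldsymbol{\beta}}$) is the largest $n$ such that $1^n$ occurs in $\boldsymbol{\alpha}$ (resp. $0^n$ occurs in $\boldsymbol{\beta}$). $B_n(\Sigma)$ is the set of words of length $n$ occurring in elements of $\Sigma$, and $\mathcal L(\Sigma)=\bigcup_{n\ge1}B_n(\Sigma)$. **Transitivity, specification, coded.** $\Sigma_{(\boldsymbol{\alpha},\boldsymbol{\beta})}$ is transitive if for all $\omega,\nu\in\mathcal L(\Sigma_{(\boldsymbol{\alpha},\boldsymbol{\beta})})$ there is $\upsilon\in\mathcal L(\Sigma_{(\boldsymbol{\alpha},\boldsymbol{\beta})})$ with $\omega\upsilon\nu\in\mathcal L(\Sigma_{(\boldsymbol{\alpha},\boldsymbol{\beta})})$; it has the specification property if it is transitive and there is $M\in\mathbb N$ such that $\upsilon$ can always be chosen with $\ell(\upsilon)=M$. It is coded if there are transitive lexicographic subshifts of finite type $\Sigma_{(\boldsymbol{\alpha}_n,\boldsymbol{\beta}_n)}\subset\Sigma_{(\boldsymbol{\alpha}_{n+1},\boldsymbol{\beta}_{n+1})}$ ($n\in\mathbb N$) with $\Sigma_{(\boldsymbol{\alpha},\boldsymbol{\beta})}=\overline{\bigcup_n\Sigma_{(\boldsymbol{\alpha}_n,\boldsymbol{\beta}_n)}}$. **Specification number.** For a pair $(\boldsymbol{\alpha},\boldsymbol{\beta})$ let $m_n=\inf\{k\in\mathbb N:\text{for all }\omega,\nu\in B_n(\Sigma_{(\boldsymbol{\alpha},\boldsymbol{\beta})})\text{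 there is }\upsilon\in B_k(\Sigma_{(\boldsymbol{\alpha},\boldsymbol{\beta})})\text{ with }\omega\upsilon\nu\in\mathcal L(\Sigma_{(\boldsymbol{\alpha},\boldsymbol{\beta})})\}$. For an essential pair, $s_{(\boldsymbol{\alpha},\boldsymbol{\beta})}=\lim_{n\to\infty}m_n$. **Renormalisable.** $(\boldsymbol{\alpha},\boldsymbol{\beta})\in\mathcal{LW}$ is renormalisable if there are words $\omega,\nu$ and sequences $\{n^\omega_i\},\{n^\nu_i\},\{m^\omega_j\},\{m^\nu_j\}\subset\mathbb N\cup\{\infty\}$ with $\omega=0\text{-}\max_\omega$, $\nu=1\text{-}\min_\nu$, $(0\text{-}\max_\nu)^\infty\prec\omega^\infty$, $\nu^\infty\prec(1\text{-}\min_\omega)^\infty$ (a condition being void if the cyclic permutation does not exist), $\ell(\omega\nu)\ge3$, $0\boldsymbol{\alpha}=\omega\nu^{n^\nu_1}\omega^{n^\omega_1}\nu^{n^\nu_2}\omega^{n^\omega_2}\cdots$ and $1\boldsymbol{\beta}=\nu\omega^{m^\omega_1}\nu^{m^\nu_1}\omega^{m^\omega_2}\nu^{m^\nu_2}\cdots$ (an exponent $\infty$ terminates the expression). It is also called renormalisable (by an infinite sequence) when one of $\omega,\nu$ is an infinite sequence, with $0\boldsymbol{\alpha}=\omega\nu$, $1\boldsymbol{\beta}=\nu$ if $\nu$ is infinite, and $0\boldsymbol{\alpha}=\omega$, $1\boldsymbol{\beta}=\nu\omega$ if $\omega$ is infinite. **Essential pairs and $p_1,p_2$.** $(\boldsymbol{\alpha},\boldsymbol{\beta})\in\mathcal{LW}$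 is essential if $\boldsymbol{\alpha},\boldsymbol{\beta}$ are periodic and the pair is not renormalisable. Then $0\boldsymbol{\alpha}=\omega^\infty$, $1\boldsymbol{\beta}=\nu^\infty$ for (shortest) words $\omega=0\text{-}\max_\omega$, $\nu=1\text{-}\min_\nu$; $(\omega,\nu)$ is the associated pair. Write $\omega=\omega_{\boldsymbol{\alpha}}\nu_{\boldsymbol{\alpha}}$ with $1\text{-}\min_\omega=\nu_{\boldsymbol{\alpha}}\omega_{\boldsymbol{\alpha}}$, and $\nu=\nu_{\boldsymbol{\beta}}\omega_{\boldsymbol{\beta}}$ with $0\text{-}\max_\nu=\omega_{\boldsymbol{\beta}}\nu_{\boldsymbol{\beta}}$, where $\omega_{\boldsymbol{\alpha}},\omega_{\boldsymbol{\beta}}$ begin with $0$ and $\nu_{\boldsymbol{\alpha}},\nu_{\boldsymbol{\beta}}$ begin with $1$. ${p_1}_{(\boldsymbol{\alpha},\boldsymbol{\beta})}$ is the word among $\omega_{\boldsymbol{\alpha}},\omega_{\boldsymbol{\beta}}$ whose infinite repetition is lexicographically larger, and ${p_2}_{(\boldsymbol{\alpha},\boldsymbol{\beta})}$ is the word among $\nu_{\boldsymbol{\alpha}},\nu_{\boldsymbol{\beta}}$ whose infinite repetition is lexicographically smaller (in case of equality, the word with subscript $\boldsymbol{\alpha}$). **Approximating sequence** of a non-renormalisable $(\boldsymbol{\alpha},\boldsymbol{\beta})\in\mathcal{LW}$, $\boldsymbol{\alpha}=(a_i)$, $\boldsymbol{\beta}=(b_i)$. If $\boldsymbol{\alpha}$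 is not periodic, take $1_{\boldsymbol{\alpha}}<i_1<i_2<\cdots$ with $a_{i_m}=1$ and put $\boldsymbol{\alpha}^*_m=(a_1\ldots a_{i_m-1}0)^\infty$. If $\boldsymbol{\beta}$ is not periodic, take $0_{\boldsymbol{\beta}}<j_1<j_2<\cdots$ with $b_{j_m}=0$ and put $\boldsymbol{\beta}^*_m=(b_1\ldots b_{j_m-1}1)^\infty$. (i) If only $\boldsymbol{\alpha}$ is non-periodic, $\{\boldsymbol{\alpha}_n\}$ is a subsequence of $\{\boldsymbol{\alpha}^*_m\}$ with terms in $\Sigma_{(\boldsymbol{\alpha},\boldsymbol{\beta})}$, converging to $\boldsymbol{\alpha}$, and $\boldsymbol{\beta}_n=\boldsymbol{\beta}$. (ii) If only $\boldsymbol{\beta}$ is non-periodic, symmetrically $\boldsymbol{\alpha}_n=\boldsymbol{\alpha}$ and $\{\boldsymbol{\beta}_n\}$ is a subsequence of $\{\boldsymbol{\beta}^*_m\}$ with terms in $\Sigma_{(\boldsymbol{\alpha},\boldsymbol{\beta})}$ converging to $\boldsymbol{\beta}$. (iii) If both are non-periodic, the $(\boldsymbol{\alpha}_n,\boldsymbol{\beta}_n)$ are taken from $\{(\boldsymbol{\alpha}^*_m,\boldsymbol{\beta}^*_l)\}_{m,l}$ with limit $(\boldsymbol{\alpha},\boldsymbol{\beta})$. (iv) If both are periodic the sequence is constant. In all cases the pairs are in $\mathcal{LW}$ and are chosen to be essential, the $\Sigma_{(\boldsymbol{\alpha}_n,\boldsymbol{\beta}_n)}$ are transitive subshifts of finite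 type increasing in $n$, and $\Sigma_{(\boldsymbol{\alpha},\boldsymbol{\beta})}=\overline{\bigcup_n\Sigma_{(\boldsymbol{\alpha}_n,\boldsymbol{\beta}_n)}}$. *)

theory Defs
  imports
    "HOL-Analysis.Analysis"
    "HOL-Library.Omega_Words_Fun"
    "HOL-Library.Fun_Lexorder"
    "HOL-Library.List_Lexorder"
begin

text \<open>
  The digits 0 and 1 are \<^term>\<open>False\<close> and \<^term>\<open>True\<close>, so that the full shift space is the whole
  type \<open>nat \<Rightarrow> bool\<close>, carrying the product topology of discrete two-point spaces.  Sequences are
  indexed from 0, that is, the \<open>i\<close>-th digit of \<open>x\<close> is \<open>x (i - 1)\<close> for \<open>i \<ge> 1\<close>.
  The \<open>n\<close>-th iterate of the one-sided shift is \<open>suffix n\<close>, \<open>w \<frown> x\<close> is the concatenation of a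
  word and a sequence, and \<open>w\<^sup>\<omega>\<close> is the infinite repetition of a (nonempty) word.
\<close>

type_synonym bseq = "bool word"
type_synonym bword = "bool list"

abbreviation lex_less :: "bseq \<Rightarrow> bseq \<Rightarrow> bool"  (infix \<open>\<prec>\<close> 50)
  where "x \<prec> y \<equiv> less_fun x y"

definition lex_le :: "bseq \<Rightarrow> bseq \<Rightarrow> bool"  (infix \<open>\<preceq>\<close> 50)
  where "x \<preceq> y \<longleftrightarrow> x \<prec> y \<or> x = y"

definition Sigma1 :: "bseq set" where "Sigma1 = {x. x 0}"
definition Sigma0 :: "bseq set" where "Sigma0 = {x. \<not> x 0}"

definition lex_shift :: "bseq \<Rightarrow> bseq \<Rightarrow> bseq set"
  where "lex_shift \<alpha> \<beta> = {x. \<forall>n. \<beta> \<preceq> suffix n x \<and> suffix n x \<preceq> \<alpha>}"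

definition P :: "bseq set"
  where "P = {\<alpha> \<in> Sigma1. \<forall>n\<ge>1. suffix n \<alpha> \<preceq> \<alpha>}"

definition mirror :: "bseq \<Rightarrow> bseq" where "mirror x = (\<lambda>i. \<not> x i)"

definition P_bar :: "bseq set"
  where "P_bar = {x \<in> Sigma0. mirror x \<in> P}"

definition LW :: "(bseq \<times> bseq) set"
  where "LW = {(\<alpha>, \<beta>) \<in> P \<times> P_bar. \<forall>n\<ge>1. \<beta> \<preceq> suffix n \<alpha> \<and> suffix n \<beta> \<preceq> \<alpha>}"


section \<open>Words, languages and subshifts\<close>

definition occurs :: "bword \<Rightarrow> bseq \<Rightarrow> bool"
  where "occurs w x \<longleftrightarrow> (\<exists>n. w = x [n \<rightarrow> n + length w])"

definition B :: "nat \<Rightarrow> bseq set \<Rightarrow> bword set"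
  where "B n X = {w. length w = n \<and> (\<exists>x\<in>X. occurs w x)}"

definition lang :: "bseq set \<Rightarrow> bword set"
  where "lang X = (\<Union>n\<in>{1..}. B n X)"

definition transitive_shift :: "bseq set \<Rightarrow> bool"
  where "transitive_shift X \<longleftrightarrow>
    (\<forall>w\<in>lang X. \<forall>v\<in>lang X. \<exists>u\<in>lang X. w @ u @ v \<in> lang X)"

definition specification_property :: "bseq set \<Rightarrow> bool"
  where "specification_property X \<longleftrightarrow> transitive_shift X \<and>
    (\<exists>M\<ge>1. \<forall>w\<in>lang X. \<forall>v\<in>lang X. \<exists>u\<in>lang X. length u = M \<and> w @ u @ v \<in> lang X)"

definition finite_type :: "bseq set \<Rightarrow> bool"
  where "finite_type X \<longleftrightarrow> (\<exists>F. finite F \<and> X = {x. \<forall>w\<in>F. \<not> occurs w x})"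

text \<open>Coded systems are considered among the lexicographic subshifts only.\<close>

definition coded :: "bseq \<Rightarrow> bseq \<Rightarrow> bool"
  where "coded \<alpha> \<beta> \<longleftrightarrow>
    (\<exists>\<alpha>s \<beta>s :: nat \<Rightarrow> bseq.
      (\<forall>n. \<alpha>s n \<in> Sigma1 \<and> \<beta>s n \<in> Sigma0 \<and>
           transitive_shift (lex_shift (\<alpha>s n) (\<beta>s n)) \<and>
           finite_type (lex_shift (\<alpha>s n) (\<beta>s n)) \<and>
           lex_shift (\<alpha>s n) (\<beta>s n) \<subseteq> lex_shift (\<alpha>s (Suc n)) (\<beta>s (Suc n))) \<and>
      lex_shift \<alpha> \<beta> = closure (\<Union>n. lex_shift (\<alpha>s n) (\<beta>s n)))"

text \<open>
  The infimum of the empty set is \<open>\<infinity>\<close>, hence the extended naturals.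
\<close>

definition gap_number :: "bseq \<Rightarrow> bseq \<Rightarrow> nat \<Rightarrow> enat"
  where "gap_number \<alpha> \<beta> n =
    Inf (enat ` {k. k \<ge> 1 \<and>
      (\<forall>w\<in>B n (lex_shift \<alpha> \<beta>). \<forall>v\<in>B n (lex_shift \<alpha> \<beta>).
        \<exists>u\<in>B k (lex_shift \<alpha> \<beta>). w @ u @ v \<in> lang (lex_shift \<alpha> \<beta>))})"

definition specification_number :: "bseq \<Rightarrow> bseq \<Rightarrow> enat"
  where "specification_number \<alpha> \<beta> = lim (gap_number \<alpha> \<beta>)"


section \<open>Renormalisation\<close>

text \<open>
  \<open>zero_max w\<close> exists only if \<open>w\<close> contains the digit 0, and \<open>one_min w\<close> only if \<open>w\<close> contains the
  digit 1.  The order on words is the lexicographic one.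
\<close>

definition zero_max :: "bword \<Rightarrow> bword"
  where "zero_max w = Max {v. (\<exists>k. v = rotate k w) \<and> v \<noteq> [] \<and> hd v = False}"

definition one_min :: "bword \<Rightarrow> bword"
  where "one_min w = Min {v. (\<exists>k. v = rotate k w) \<and> v \<noteq> [] \<and> hd v = True}"

text \<open>
  \<open>alternation u v p q x\<close> states that \<open>x\<close> is the infinite concatenation of \<open>p 0\<close> copies of \<open>u\<close>,
  \<open>q 0\<close> copies of \<open>v\<close>, \<open>p 1\<close> copies of \<open>u\<close>, \<open>q 1\<close> copies of \<open>v\<close>, and so on, terminated by the first
  exponent \<open>\<infinity>\<close>.
  If \<open>u\<close> and \<open>v\<close> are nonempty and all exponents are positive, then the coinductive reading
  determines \<open>x\<close> uniquely.
\<close>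

coinductive alternation ::
    "bword \<Rightarrow> bword \<Rightarrow> (nat \<Rightarrow> enat) \<Rightarrow> (nat \<Rightarrow> enat) \<Rightarrow> bseq \<Rightarrow> bool"
  where
    last: "p 0 = \<infinity> \<Longrightarrow> alternation u v p q (u\<^sup>\<omega>)"
  | step: "p 0 = enat n \<Longrightarrow> alternation v u q (\<lambda>i. p (Suc i)) x \<Longrightarrow>
             alternation u v p q (concat (replicate n u) \<frown> x)"

definition renormalisable_by_words :: "bseq \<Rightarrow> bseq \<Rightarrow> bool"
  where "renormalisable_by_words \<alpha> \<beta> \<longleftrightarrow>
    (\<exists>\<omega> \<nu> n\<omega> n\<nu> m\<omega> m\<nu>.
      False \<in> set \<omega> \<and> \<omega> = zero_max \<omega> \<and>
      True \<in> set \<nu> \<and> \<nu> = one_min \<nu> \<and>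
      (False \<in> set \<nu> \<longrightarrow> (zero_max \<nu>)\<^sup>\<omega> \<prec> \<omega>\<^sup>\<omega>) \<and>
      (True \<in> set \<omega> \<longrightarrow> \<nu>\<^sup>\<omega> \<prec> (one_min \<omega>)\<^sup>\<omega>) \<and>
      length (\<omega> @ \<nu>) \<ge> 3 \<and>
      (\<forall>i. n\<omega> i \<ge> 1 \<and> n\<nu> i \<ge> 1 \<and> m\<omega> i \<ge> 1 \<and> m\<nu> i \<ge> 1) \<and>
      (\<exists>x. alternation \<nu> \<omega> n\<nu> n\<omega> x \<and> [False] \<frown> \<alpha> = \<omega> \<frown> x) \<and>
      (\<exists>y. alternation \<omega> \<nu> m\<omega> m\<nu> y \<and> [True] \<frown> \<beta> = \<nu> \<frown> y))"

definition renormalisable_by_sequence :: "bseq \<Rightarrow> bseq \<Rightarrow> bool"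
  where "renormalisable_by_sequence \<alpha> \<beta> \<longleftrightarrow>
    (\<exists>(\<omega> :: bword) (\<nu> :: bseq). [False] \<frown> \<alpha> = \<omega> \<frown> \<nu> \<and> [True] \<frown> \<beta> = \<nu>) \<or>
    (\<exists>(\<omega> :: bseq) (\<nu> :: bword). [False] \<frown> \<alpha> = \<omega> \<and> [True] \<frown> \<beta> = \<nu> \<frown> \<omega>)"

definition renormalisable :: "bseq \<Rightarrow> bseq \<Rightarrow> bool"
  where "renormalisable \<alpha> \<beta> \<longleftrightarrow>
    renormalisable_by_words \<alpha> \<beta> \<or> renormalisable_by_sequence \<alpha> \<beta>"


section \<open>Essential pairs\<close>

definition periodic :: "bseq \<Rightarrow> bool"
  where "periodic x \<longleftrightarrow> (\<exists>p\<ge>1. suffix p x = x)"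

definition essential :: "bseq \<Rightarrow> bseq \<Rightarrow> bool"
  where "essential \<alpha> \<beta> \<longleftrightarrow>
    (\<alpha>, \<beta>) \<in> LW \<and> periodic \<alpha> \<and> periodic \<beta> \<and> \<not> renormalisable \<alpha> \<beta>"

definition period_word :: "bseq \<Rightarrow> bword"
  where "period_word x = (ARG_MIN length w. w \<noteq> [] \<and> x = w\<^sup>\<omega>)"

text \<open>
  The associated pair.  For a pair in \<^term>\<open>LW\<close>, the words exist for all periodic \<open>\<alpha>\<close> and \<open>\<beta>\<close> except
  \<open>\<alpha> = 1\<^sup>\<omega>\<close> and \<open>\<beta> = 0\<^sup>\<omega>\<close>, respectively, where they are left unspecified.
\<close>

definition omega_word :: "bseq \<Rightarrow> bword"
  where "omega_word \<alpha> = period_word ([False] \<frown> \<alpha>)"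

definition nu_word :: "bseq \<Rightarrow> bword"
  where "nu_word \<beta> = period_word ([True] \<frown> \<beta>)"

text \<open>The pairs \<open>(\<omega>\<^sub>\<alpha>, \<nu>\<^sub>\<alpha>)\<close> and \<open>(\<nu>\<^sub>\<beta>, \<omega>\<^sub>\<beta>)\<close>.\<close>

definition split_alpha :: "bseq \<Rightarrow> bword \<times> bword"
  where "split_alpha \<alpha> =
    (THE (u, v). omega_word \<alpha> = u @ v \<and> one_min (omega_word \<alpha>) = v @ u \<and>
       u \<noteq> [] \<and> hd u = False \<and> v \<noteq> [] \<and> hd v = True)"

definition split_beta :: "bseq \<Rightarrow> bword \<times> bword"
  where "split_beta \<beta> =
    (THE (v, u). nu_word \<beta> = v @ u \<and> zero_max (nu_word \<beta>) = u @ v \<and>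
       u \<noteq> [] \<and> hd u = False \<and> v \<noteq> [] \<and> hd v = True)"

definition p1 :: "bseq \<Rightarrow> bseq \<Rightarrow> bword"
  where "p1 \<alpha> \<beta> =
    (let \<omega>\<alpha> = fst (split_alpha \<alpha>); \<omega>\<beta> = snd (split_beta \<beta>)
     in if \<omega>\<alpha>\<^sup>\<omega> \<prec> \<omega>\<beta>\<^sup>\<omega> then \<omega>\<beta> else \<omega>\<alpha>)"

definition p2 :: "bseq \<Rightarrow> bseq \<Rightarrow> bword"
  where "p2 \<alpha> \<beta> =
    (let \<nu>\<alpha> = snd (split_alpha \<alpha>); \<nu>\<beta> = fst (split_beta \<beta>)
     in if \<nu>\<beta>\<^sup>\<omega> \<prec> \<nu>\<alpha>\<^sup>\<omega> then \<nu>\<beta> else \<nu>\<alpha>)"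


section \<open>Approximating sequences\<close>

text \<open>
  Only used for non-periodic \<open>\<alpha>\<close> in \<^term>\<open>P\<close> and \<open>\<beta>\<close> in \<^term>\<open>P_bar\<close>, where the maxima exist.
\<close>

definition ones :: "bseq \<Rightarrow> nat"
  where "ones \<alpha> = (GREATEST n. occurs (replicate n True) \<alpha>)"

definition zeros :: "bseq \<Rightarrow> nat"
  where "zeros \<beta> = (GREATEST n. occurs (replicate n False) \<beta>)"

text \<open>The positions \<open>i m\<close> and \<open>j m\<close> below are counted from 1.\<close>

definition one_positions :: "bseq \<Rightarrow> (nat \<Rightarrow> nat) \<Rightarrow> bool"
  where "one_positions \<alpha> i \<longleftrightarrow>
    strict_mono i \<and> (\<forall>m. ones \<alpha> < i m \<and> \<alpha> (i m - 1) = True)"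

definition zero_positions :: "bseq \<Rightarrow> (nat \<Rightarrow> nat) \<Rightarrow> bool"
  where "zero_positions \<beta> j \<longleftrightarrow>
    strict_mono j \<and> (\<forall>m. zeros \<beta> < j m \<and> \<beta> (j m - 1) = False)"

definition alpha_star :: "bseq \<Rightarrow> nat \<Rightarrow> bseq"
  where "alpha_star \<alpha> i = (prefix (i - 1) \<alpha> @ [False])\<^sup>\<omega>"

definition beta_star :: "bseq \<Rightarrow> nat \<Rightarrow> bseq"
  where "beta_star \<beta> j = (prefix (j - 1) \<beta> @ [True])\<^sup>\<omega>"

definition approximating_sequence ::
    "bseq \<Rightarrow> bseq \<Rightarrow> (nat \<Rightarrow> bseq) \<Rightarrow> (nat \<Rightarrow> bseq) \<Rightarrow> bool"
  where "approximating_sequence \<alpha> \<beta> \<alpha>s \<beta>s \<longleftrightarrow>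
    (\<not> periodic \<alpha> \<and> periodic \<beta> \<longrightarrow>
      (\<exists>i r. one_positions \<alpha> i \<and> strict_mono r \<and>
         (\<forall>n. \<alpha>s n = alpha_star \<alpha> (i (r n)) \<and> \<alpha>s n \<in> lex_shift \<alpha> \<beta> \<and> \<beta>s n = \<beta>)) \<and>
      \<alpha>s \<longlonglongrightarrow> \<alpha>) \<and>
    (periodic \<alpha> \<and> \<not> periodic \<beta> \<longrightarrow>
      (\<exists>j r. zero_positions \<beta> j \<and> strict_mono r \<and>
         (\<forall>n. \<beta>s n = beta_star \<beta> (j (r n)) \<and> \<beta>s n \<in> lex_shift \<alpha> \<beta> \<and> \<alpha>s n = \<alpha>)) \<and>
      \<beta>s \<longlonglongrightarrow> \<beta>) \<and>
    (\<not> periodic \<alpha> \<and> \<not> periodic \<beta> \<longrightarrow>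
      (\<exists>i j. one_positions \<alpha> i \<and> zero_positions \<beta> j \<and>
         (\<forall>n. \<exists>m l. \<alpha>s n = alpha_star \<alpha> (i m) \<and> \<beta>s n = beta_star \<beta> (j l))) \<and>
      \<alpha>s \<longlonglongrightarrow> \<alpha> \<and> \<beta>s \<longlonglongrightarrow> \<beta>) \<and>
    (periodic \<alpha> \<and> periodic \<beta> \<longrightarrow> (\<forall>n. \<alpha>s n = \<alpha> \<and> \<beta>s n = \<beta>)) \<and>
    (\<forall>n. essential (\<alpha>s n) (\<beta>s n) \<and>
         transitive_shift (lex_shift (\<alpha>s n) (\<beta>s n)) \<and>
         finite_type (lex_shift (\<alpha>s n) (\<beta>s n)) \<and>
         lex_shift (\<alpha>s n) (\<beta>s n) \<subseteq> lex_shift (\<alpha>s (Suc n)) (\<beta>s (Suc n))) \<and>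
    lex_shift \<alpha> \<beta> = closure (\<Union>n. lex_shift (\<alpha>s n) (\<beta>s n))"

end

theory Submission
  imports Defs
begin

text \<open>
  A gap \<open>M\<close> for the limit shift \<open>X\<close> forces a uniform gap for all late approximants, so their
  specification numbers are bounded, while the hypothesis makes them unbounded.

  If \<open>\<alpha>\<close> contained a prefix of \<open>\<beta>\<close> of length \<open>M + 1\<close> (or conversely), then the digits after that
  occurrence would be squeezed between \<open>\<beta>\<close> and a shift of \<open>\<alpha>\<close> for more than \<open>M\<close> steps, contradicting
  specification. Hence a word \<open>s\<close> containing both prefixes occurs neither in \<open>\<alpha>\<close> nor in \<open>\<beta>\<close>, which
  makes it synchronizing in \<open>X\<close> and in every approximant.

  An approximant consists of the points of \<open>X\<close> avoiding a prefix of \<open>\<alpha>\<close> and a prefix of \<open>\<beta>\<close> whose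
  lengths tend to infinity (nothing is avoided for a periodic bound). A bridge of \<open>X\<close> can thus fail in
  the approximant only if such a long prefix overlaps it. If a bridge from a word to \<open>s\<close> fails at
  several well-chosen places, then the bound agrees with a shift of itself and is periodic. If
  bridges from \<open>s\<close> to \<open>v\<close> and to several left extensions of \<open>v\<close> fail, then the bound has a periodic
  tail \<open>\<theta>\<close> and \<open>v\<close> nearly equals \<open>\<theta>\<close>; transitivity of the approximant provides an entrance into the
  orbit of \<open>\<theta>\<close> within one period, and through it a left extension that does not fail. Padding with
  words from \<open>s\<close> to \<open>s\<close> makes all gaps equal.
\<close>

section \<open>Lexicographic shifts\<close>

text \<open>
  Both bounds are treated at once: \<open>dless True\<close> is the lexicographic order, \<open>dless False\<close> its
  converse, and a pair \<open>(\<alpha>, \<beta>)\<close> is a map \<open>g\<close> with \<open>g True = \<alpha>\<close> and \<open>g False = \<beta>\<close>.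
\<close>

definition agree :: "nat \<Rightarrow> bseq \<Rightarrow> bseq \<Rightarrow> bool"
  where "agree n x y \<longleftrightarrow> (\<forall>i<n. x i = y i)"

definition dless :: "bool \<Rightarrow> bseq \<Rightarrow> bseq \<Rightarrow> bool"
  where "dless c x y \<longleftrightarrow> (\<exists>n. agree n x y \<and> x n = (\<not> c) \<and> y n = c)"

definition lshift :: "(bool \<Rightarrow> bseq) \<Rightarrow> bseq set"
  where "lshift g = {x. \<forall>c n. \<not> dless c (g c) (suffix n x)}"

section \<open>Finite agreement and the two directions of the order\<close>

lemma agree_sym: "agree n x y \<Longrightarrow> agree n y x"
  by (simp add: agree_def)

lemma agree_trans: "agree n x y \<Longrightarrow> agree n y z \<Longrightarrow> agree n x z"
  by (simp add: agree_def)

lemma agree_mono: "agree n x y \<Longrightarrow> m \<le> n \<Longrightarrow> agree m x y"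
  by (simp add: agree_def)

lemma agree_refl [simp]: "agree n x x"
  by (simp add: agree_def)

lemma agree_nth: "agree n x y \<Longrightarrow> i < n \<Longrightarrow> x i = y i"
  by (simp add: agree_def)

lemma agree_suffix: "agree n x y \<Longrightarrow> agree (n - m) (suffix m x) (suffix m y)"
  by (simp add: agree_def)

lemma agree_conc: "agree n x y \<Longrightarrow> agree (length w + n) (w \<frown> x) (w \<frown> y)"
  by (simp add: agree_def conc_def)

lemma agree_prefix_conc: "agree n x (prefix n x \<frown> y)"
  by (simp add: agree_def)

lemma dlessI: "agree n x y \<Longrightarrow> x n = (\<not> c) \<Longrightarrow> y n = c \<Longrightarrow> dless c x y"
  by (auto simp: dless_def)

lemma dless_cases: obtains "x = y" | "dless c x y" | "dless c y x"
proof (cases "x = y")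
  case False
  define n where "n = (LEAST n. x n \<noteq> y n)"
  have "\<exists>n. x n \<noteq> y n" using False by auto
  then have n: "x n \<noteq> y n" unfolding n_def by (rule LeastI_ex)
  have a: "agree n x y" unfolding agree_def n_def using not_less_Least by blast
  show ?thesis
  proof (cases "y n = c")
    case True
    then show ?thesis using that(2) a n dlessI[of n x y c] by blast
  next
    case False
    then show ?thesis using that(3) agree_sym[OF a] n dlessI[of n y x c] by blast
  qed
qed (rule that(1))

lemma dless_trans: assumes "dless c x y" "dless c y z" shows "dless c x z"
proof -
  obtain n m where n: "agree n x y" "x n = (\<not> c)" "y n = c"
    and m: "agree m y z" "y m = (\<not> c)" "z m = c"
    using assms unfolding dless_def by blast
  consider "n < m" | "m < n" | "m = n" by linarith
  then show ?thesis
  proof cases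
    case 1
    then show ?thesis using n m by (intro dlessI[of n]) (auto simp: agree_def)
  next
    case 2
    then show ?thesis using n m by (intro dlessI[of m]) (auto simp: agree_def)
  next
    case 3
    then show ?thesis using n m by auto
  qed
qed

lemma dless_irrefl [simp]: "\<not> dless c x x"
  by (auto simp: dless_def)

lemma dless_not_less_trans: "dless c x z \<Longrightarrow> \<not> dless c x y \<Longrightarrow> dless c y z"
  by (rule dless_cases[where x=x and y=y and c=c]) (auto intro: dless_trans)

lemma not_less_dless_trans: "dless c x z \<Longrightarrow> \<not> dless c y z \<Longrightarrow> dless c x y"
  by (rule dless_cases[where x=y and y=z and c=c]) (auto intro: dless_trans)

lemma dless_build_iff [simp]: "dless c (e ## x) (e ## y) \<longleftrightarrow> dless c x y"
proof
  assume "dless c (e ## x) (e ## y)"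
  then obtain n where n: "agree n (e ## x) (e ## y)" "(e ## x) n = (\<not> c)" "(e ## y) n = c"
    unfolding dless_def by blast
  then obtain m where m: "n = Suc m" by (cases n) auto
  then show "dless c x y" using n unfolding agree_def by (intro dlessI[of m]) (auto simp: agree_def)
next
  assume "dless c x y"
  then obtain n where n: "agree n x y" "x n = (\<not> c)" "y n = c"
    unfolding dless_def by blast
  then show "dless c (e ## x) (e ## y)"
    by (intro dlessI[of "Suc n"]) (auto simp: agree_def less_Suc_eq_0_disj)
qed

section \<open>Shift invariance, closedness, languages and compactness\<close>

lemma lshift_suffix: "x \<in> lshift g \<Longrightarrow> suffix n x \<in> lshift g"
  by (simp add: lshift_def)

lemma lshift_conc: "w \<frown> x \<in> lshift g \<Longrightarrow> x \<in> lshift g"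
  using lshift_suffix[of "w \<frown> x" g "length w"] by simp

lemma lshift_build: "e ## x \<in> lshift g \<Longrightarrow> x \<in> lshift g"
  using lshift_conc[of "[e]" x g] by simp

text \<open>Exceeding a bound is visible on finitely many digits.\<close>

lemma lshift_closed:
  assumes "\<And>n. \<exists>y\<in>lshift g. agree n x y" shows "x \<in> lshift g"
proof (rule ccontr)
  assume "x \<notin> lshift g"
  then obtain c m where "dless c (g c) (suffix m x)" by (auto simp: lshift_def)
  then obtain n where n: "agree n (g c) (suffix m x)" "g c n = (\<not> c)" "suffix m x n = c"
    by (auto simp: dless_def)
  obtain y where y: "y \<in> lshift g" "agree (m + n + 1) x y" using assms by blast
  have "dless c (g c) (suffix m y)"
    using n y(2) by (intro dlessI[of n]) (auto simp: agree_def)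
  then show False using y(1) by (auto simp: lshift_def)
qed

lemma lang_iff:
  "w \<in> lang (lshift g) \<longleftrightarrow> w \<noteq> [] \<and> (\<exists>y. w \<frown> y \<in> lshift g)"
proof
  assume "w \<in> lang (lshift g)"
  then obtain x n where x: "x \<in> lshift g" "w = x [n \<rightarrow> n + length w]" "length w \<ge> 1"
    by (auto simp: lang_def B_def occurs_def)
  have "w \<frown> suffix (n + length w) x = suffix n x"
    by (subst x(2)) simp
  then show "w \<noteq> [] \<and> (\<exists>y. w \<frown> y \<in> lshift g)"
    using lshift_suffix[OF x(1), of n] x(3) by (metis One_nat_def Suc_le_length_iff list.distinct(1))
next
  assume a: "w \<noteq> [] \<and> (\<exists>y. w \<frown> y \<in> lshift g)"
  then obtain y where y: "w \<frown> y \<in> lshift g" by blast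
  have "occurs w (w \<frown> y)" unfolding occurs_def by (rule exI[of _ 0]) simp
  with a y show "w \<in> lang (lshift g)"
    unfolding lang_def B_def by (auto simp: Suc_le_eq)
qed

lemma occurs_iff: "occurs w x \<longleftrightarrow> (\<exists>n. \<forall>j<length w. x (n + j) = w ! j)"
proof -
  have "w = x [n \<rightarrow> n + length w] \<longleftrightarrow> (\<forall>j<length w. x (n + j) = w ! j)" for n
    unfolding list_eq_iff_nth_eq by (simp add: eq_commute[of "w ! _"])
  then show ?thesis unfolding occurs_def by blast
qed

lemma lang_appendD:
  assumes "p @ w @ q \<in> lang (lshift g)" "w \<noteq> []" shows "w \<in> lang (lshift g)"
proof -
  obtain y where "(p @ w @ q) \<frown> y \<in> lshift g" using assms(1) lang_iff by blast
  then have "p \<frown> (w \<frown> q \<frown> y) \<in> lshift g" by simp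
  then show ?thesis using lshift_conc lang_iff assms(2) by blast
qed

lemma ex_constant_infinitely_often:
  assumes "\<And>n::nat. \<exists>u\<in>U. R n u" "finite U" "\<And>n m u. R n u \<Longrightarrow> m \<le> n \<Longrightarrow> R m u"
  shows "\<exists>u\<in>U. \<forall>n. R n u"
proof (rule ccontr)
  assume "\<not> ?thesis"
  then obtain f where f: "\<And>u. u \<in> U \<Longrightarrow> \<not> R (f u) u" by metis
  obtain u where u: "u \<in> U" "R (Max (f ` U)) u" using assms(1) by blast
  then have "R (f u) u" using assms(2,3) by (meson Max_ge finite_imageI imageI)
  then show False using f u by blast
qed

text \<open>There are finitely many words of length \<open>m\<close>, so one \<open>u\<close> works
  for arbitrarily long prefixes of \<open>z\<close>, and closedness passes to \<open>z\<close>. This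
  turns specification, which speaks of words, into bridges ending in a whole point.\<close>

lemma lshift_conc_compact:
  assumes "\<And>n. \<exists>u y. length u = m \<and> w \<frown> u \<frown> prefix n z \<frown> y \<in> lshift g"
  shows "\<exists>u. length u = m \<and> w \<frown> u \<frown> z \<in> lshift g"
proof -
  let ?U = "{u. set u \<subseteq> (UNIV :: bool set) \<and> length u = m}"
  have fin: "finite ?U" by (rule finite_lists_length_eq) simp
  have "\<exists>u\<in>?U. \<forall>n. \<exists>y. agree n z y \<and> w \<frown> u \<frown> y \<in> lshift g"
  proof (rule ex_constant_infinitely_often)
    show "\<exists>u\<in>?U. \<exists>y. agree n z y \<and> w \<frown> u \<frown> y \<in> lshift g" for n
    proof -
      obtain u y where "length u = m" "w \<frown> u \<frown> prefix n z \<frown> y \<in> lshift g"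
        using assms by blast
      then show ?thesis using agree_prefix_conc[of n z y]
        by (intro bexI[of _ u] exI[of _ "prefix n z \<frown> y"]) auto
    qed
    show "finite ?U" by (fact fin)
    show "\<exists>y. agree m z y \<and> w \<frown> u \<frown> y \<in> lshift g"
      if "\<exists>y. agree n z y \<and> w \<frown> u \<frown> y \<in> lshift g" "m \<le> n" for n m u
      using that agree_mono by blast
  qed
  then obtain u where u: "length u = m" "\<And>n. \<exists>y. agree n z y \<and> w \<frown> u \<frown> y \<in> lshift g" by auto
  have "w \<frown> u \<frown> z \<in> lshift g"
  proof (rule lshift_closed)
    fix n
    obtain y where y: "agree n z y" "w \<frown> u \<frown> y \<in> lshift g" using u(2) by blast
    have "agree n (w \<frown> u \<frown> z) (w \<frown> u \<frown> y)"
      using agree_conc[OF y(1), of "w @ u"] by (auto intro: agree_mono)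
    then show "\<exists>y\<in>lshift g. agree n (w \<frown> u \<frown> z) y" using y(2) by blast
  qed
  then show ?thesis using u(1) by blast
qed

section \<open>Left extensions in transitive shifts\<close>

lemma transitive_left_extendable:
  assumes "transitive_shift (lshift g)" "z \<in> lshift g"
  shows "\<exists>e. e ## z \<in> lshift g"
proof -
  have "\<exists>u. length u = 1 \<and> [] \<frown> u \<frown> z \<in> lshift g"
  proof (rule lshift_conc_compact)
    fix n
    \<comment> \<open>Transitivity joins a prefix of \<open>z\<close> to itself; the last digit of
      the connecting word is a possible left neighbour of \<open>z\<close> up to digit
      \<open>n\<close>. The extra digit keeps the prefix nonempty.\<close>
    have "prefix (Suc n) z \<in> lang (lshift g)"
      unfolding lang_iff using assms(2) by (metis prefix_suffix subsequence_empty not_less_eq_eq zero_le)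
    then obtain u where u: "u \<in> lang (lshift g)"
      "prefix (Suc n) z @ u @ prefix (Suc n) z \<in> lang (lshift g)"
      using assms(1) unfolding transitive_shift_def by blast
    then have "u \<noteq> []" by (simp add: lang_iff)
    have "prefix (Suc n) z = prefix n z @ [z n]" by simp
    then have "(prefix (Suc n) z @ butlast u) @ ([last u] @ prefix n z) @ [z n] \<in> lang (lshift g)"
      using u(2) \<open>u \<noteq> []\<close> by (metis append.assoc append_butlast_last_id)
    then have "[last u] @ prefix n z \<in> lang (lshift g)"
      using lang_appendD by blast
    then show "\<exists>u y. length u = 1 \<and> [] \<frown> u \<frown> prefix n z \<frown> y \<in> lshift g"
      unfolding lang_iff by (intro exI[of _ "[last u]"]) auto
  qed
  then obtain u where "length u = 1" "u \<frown> z \<in> lshift g" by auto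
  then show ?thesis by (metis One_nat_def length_0_conv length_Suc_conv build_cons conc_empty)
qed

lemma transitive_left_extendable_word:
  assumes "transitive_shift (lshift g)" "z \<in> lshift g"
  shows "\<exists>p. length p = n \<and> p \<frown> z \<in> lshift g"
proof (induction n)
  case 0
  then show ?case using assms(2) by simp
next
  case (Suc n)
  then obtain p where p: "length p = n" "p \<frown> z \<in> lshift g" by blast
  then obtain e where "e ## p \<frown> z \<in> lshift g" using transitive_left_extendable[OF assms(1)] by blast
  then show ?case using p by (intro exI[of _ "e # p"]) simp
qed

lemma finite_separation:
  fixes G :: "bseq set"
  assumes "finite G"
  shows "\<exists>N. \<forall>x\<in>G. \<forall>y\<in>G. agree N x y \<longrightarrow> x = y"
proof -
  have "\<exists>f. \<forall>p\<in>G \<times> G. agree (f p) (fst p) (snd p) \<longrightarrow> fst p = snd p"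
    by (rule bchoice) (metis agree_def ext less_Suc_eq)
  then obtain f where f: "\<And>x y. x \<in> G \<Longrightarrow> y \<in> G \<Longrightarrow> agree (f (x, y)) x y \<Longrightarrow> x = y"
    by (metis SigmaI fst_conv snd_conv)
  have "\<forall>x\<in>G. \<forall>y\<in>G. agree (Max (f ` (G \<times> G))) x y \<longrightarrow> x = y"
    using f assms by (meson Max_ge SigmaI agree_mono finite_SigmaI finite_imageI imageI)
  then show ?thesis by blast
qed

lemma dless_conc_iff [simp]: "dless c (w \<frown> x) (w \<frown> y) \<longleftrightarrow> dless c x y"
  by (induction w) auto

lemma conc_conc_nth: "j < length v \<Longrightarrow> (u \<frown> v \<frown> x) (length u + j) = v ! j"
  by (simp del: conc_conc)

text \<open>The two bounds coincide up to digit \<open>n\<close>, so at its first departure from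
  them \<open>z\<close> would violate one or the other.\<close>

lemma squeeze_agree:
  assumes "agree n a b" "\<not> dless c a z" "\<not> dless (\<not> c) b z" shows "agree n z a"
proof (rule ccontr)
  assume "\<not> agree n z a"
  then obtain i where "i < n" "z i \<noteq> a i" by (auto simp: agree_def)
  define j where "j = (LEAST i. z i \<noteq> a i)"
  have zj: "z j \<noteq> a j" unfolding j_def by (rule LeastI[of _ i]) fact
  have "j \<le> i" unfolding j_def by (rule Least_le) fact
  have ag: "agree j a z" unfolding agree_def j_def using not_less_Least by blast
  have "b j = a j" "agree j b z"
    using \<open>j \<le> i\<close> \<open>i < n\<close> assms(1) ag by (auto simp: agree_def)
  then show False
    using assms(2,3) zj ag dlessI[of j a z c] dlessI[of j b z "\<not> c"] by metis
qed

text \<open>A violation starting in \<open>p\<close> is either visible before the end of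
  \<open>s\<close>, hence already present in \<open>p \<frown> s \<frown> y'\<close>, or it forces
  the bound to contain all of \<open>s\<close>. One starting after \<open>p\<close> belongs to
  \<open>s \<frown> y\<close>.\<close>

lemma lshift_synchronize:
  assumes "\<And>c. \<not> occurs s (g c)" "p \<frown> s \<frown> y' \<in> lshift g" "s \<frown> y \<in> lshift g"
  shows "p \<frown> s \<frown> y \<in> lshift g"
proof (rule ccontr)
  assume "p \<frown> s \<frown> y \<notin> lshift g"
  then obtain c n where "dless c (g c) (suffix n (p \<frown> s \<frown> y))" by (auto simp: lshift_def)
  then obtain d where d: "agree d (g c) (suffix n (p \<frown> s \<frown> y))" "g c d = (\<not> c)"
    "(p \<frown> s \<frown> y) (n + d) = c"
    by (auto simp: dless_def)
  have n: "n < length p"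
  proof (rule ccontr)
    assume "\<not> n < length p"
    then have "suffix n (p \<frown> s \<frown> y) = suffix (n - length p) (s \<frown> y)" by (intro suffix_conc_snd) simp
    then show False using assms(3) \<open>dless c _ _\<close> by (auto simp: lshift_def simp del: conc_conc)
  qed
  show False
  proof (cases "n + d < length p + length s")
    case True
    have "(p \<frown> s \<frown> y) i = (p \<frown> s \<frown> y') i" if "i < length p + length s" for i
      using that by simp
    then have "dless c (g c) (suffix n (p \<frown> s \<frown> y'))"
      using d True by (intro dlessI[of d]) (auto simp: agree_def simp del: conc_conc)
    then show False using assms(2) by (auto simp: lshift_def simp del: conc_conc)
  next
    case False
    have "g c (length p - n + j) = s ! j" if "j < length s" for j
    proof -
      have "g c (length p - n + j) = (p \<frown> s \<frown> y) (n + (length p - n + j))"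
        using agree_nth[OF d(1), of "length p - n + j"] False that n by (simp del: conc_conc suffix_conc_fst)
      also have "n + (length p - n + j) = length p + j" using n by simp
      finally show ?thesis using conc_conc_nth[OF that] by metis
    qed
    then have "occurs s (g c)" unfolding occurs_iff by blast
    then show False using assms(1) by blast
  qed
qed

section \<open>A synchronizing word\<close>

text \<open>\<open>M\<close> is the gap from the specification property; \<open>g0\<close> and
  \<open>g_in\<close> are what \<open>LW\<close> provides for a pair of bounds.\<close>

locale lex_gap =
  fixes g :: "bool \<Rightarrow> bseq" and M :: nat
  assumes g0 [simp]: "g c 0 = c"
    and g_in: "g c \<in> lshift g"
    and spec: "\<And>w v. w \<in> lang (lshift g) \<Longrightarrow> v \<in> lang (lshift g) \<Longrightarrow>
      \<exists>u. length u = M \<and> w @ u @ v \<in> lang (lshift g)"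
begin

lemma prefix_g_in_lang: "n \<noteq> 0 \<Longrightarrow> prefix n (g c) \<in> lang (lshift g)"
  unfolding lang_iff using g_in[of c] by (metis prefix_suffix subsequence_empty le_zero_eq)

lemma boundary_overlap:
  assumes "agree (Suc M) (suffix r (g c)) (g (\<not> c))" shows False
proof -
  have "r \<noteq> 0" using agree_nth[OF assms, of 0] by (cases r) auto
  txt \<open>Whatever follows the prefix of length \<open>r\<close> is squeezed between two sequences agreeing on
    \<open>M + 1\<close> digits, so a gap of length \<open>M\<close> leaves no choice for the next digit.\<close>
  have forced: "d = g (\<not> c) M" for d
  proof -
    have "prefix 1 (g d) \<in> lang (lshift g)" by (rule prefix_g_in_lang) simp
    then have "[d] \<in> lang (lshift g)" by simp
    then obtain u where u: "length u = M" "prefix r (g c) @ u @ [d] \<in> lang (lshift g)"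
      using spec prefix_g_in_lang[OF \<open>r \<noteq> 0\<close>] by blast
    then obtain y where "(prefix r (g c) @ u @ [d]) \<frown> y \<in> lshift g" unfolding lang_iff by blast
    then have x: "prefix r (g c) \<frown> ((u @ [d]) \<frown> y) \<in> lshift g"
      unfolding conc_conc append_assoc .
    define z where "z = (u @ [d]) \<frown> y"
    have "\<not> dless c (suffix r (g c)) z"
    proof
      assume "dless c (suffix r (g c)) z"
      then have "dless c (g c) (prefix r (g c) \<frown> z)"
        using dless_conc_iff[of c "prefix r (g c)" "suffix r (g c)" z] by simp
      then show False using x unfolding z_def lshift_def
        by (metis (mono_tags, lifting) mem_Collect_eq suffix_0)
    qed
    moreover have "\<not> dless (\<not> c) (g (\<not> c)) z"
      using lshift_conc[OF x] unfolding z_def lshift_def by (metis (mono_tags, lifting) mem_Collect_eq suffix_0)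
    ultimately have "agree (Suc M) z (suffix r (g c))" by (rule squeeze_agree[OF assms])
    then have "agree (Suc M) z (g (\<not> c))" using assms agree_trans by blast
    then have "z M = g (\<not> c) M" by (rule agree_nth) simp
    then show ?thesis using u(1) by (auto simp: z_def conc_def)
  qed
  show False using forced[of True] forced[of False] by simp
qed

text \<open>By \<open>boundary_overlap\<close> neither bound contains a long prefix of the other, so
  a word containing long prefixes of both occurs in neither.\<close>

lemma synchronizing_word:
  obtains s where "s \<in> lang (lshift g)" "\<And>c. \<not> occurs s (g c)"
proof -
  obtain u where u: "prefix (Suc M) (g False) @ u @ prefix (Suc M) (g True) \<in> lang (lshift g)"
    using spec prefix_g_in_lang by (metis nat.distinct(1))
  let ?s = "prefix (Suc M) (g False) @ u @ prefix (Suc M) (g True)"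
  have "\<not> occurs ?s (g c)" for c
  proof
    assume "occurs ?s (g c)"
    then obtain n where n: "\<And>j. j < length ?s \<Longrightarrow> g c (n + j) = ?s ! j" unfolding occurs_iff by blast
    have *: "agree (Suc M) (suffix n (g c)) (g False)"
      unfolding agree_def
    proof (intro allI impI)
      fix i assume "i < Suc M"
      then show "suffix n (g c) i = g False i"
        using n[of i] by (simp add: nth_append del: subseq_to_Suc)
    qed
    have **: "agree (Suc M) (suffix (n + Suc M + length u) (g c)) (g True)"
      unfolding agree_def
    proof (intro allI impI)
      fix i assume "i < Suc M"
      then show "suffix (n + Suc M + length u) (g c) i = g True i"
        using n[of "Suc M + length u + i"] by (simp add: nth_append add.assoc del: subseq_to_Suc)
    qed
    show False
      using boundary_overlap[of _ c] * ** by (cases c) auto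
  qed
  then show ?thesis using that u by blast
qed

end

section \<open>Bridges in a close approximant\<close>

text \<open>
  For \<open>\<theta>\<close> of period \<open>\<pi>\<close>, \<open>lext \<theta> \<pi> n x\<close> puts in front of \<open>x\<close> the \<open>n\<close> digits preceding \<open>\<theta>\<close> in its
  two-sided periodic extension; modulo \<open>\<pi>\<close>, the index \<open>(\<pi> - 1) * m\<close> stands for \<open>- m\<close>.
\<close>

primrec lext :: "bseq \<Rightarrow> nat \<Rightarrow> nat \<Rightarrow> bseq \<Rightarrow> bseq"
  where "lext \<theta> \<pi> 0 x = x"
  | "lext \<theta> \<pi> (Suc n) x = \<theta> ((\<pi> - 1) * Suc n) ## lext \<theta> \<pi> n x"

lemma agree_build: "agree n x y \<Longrightarrow> agree (Suc n) (e ## x) (e ## y)"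
  by (auto simp: agree_def less_Suc_eq_0_disj)

lemma agree_build2: "agree n x y \<Longrightarrow> agree n (e ## x) (e ## y)"
  using agree_build agree_mono by (meson Suc_n_not_le_n nat_le_linear)

lemma agree_lext: "agree m x y \<Longrightarrow> agree (m + n) (lext \<theta> \<pi> n x) (lext \<theta> \<pi> n y)"
  by (induction n) (auto intro: agree_build)

lemma lext_nth [simp]: "lext \<theta> \<pi> n x (n + i) = x i"
  by (induction n) auto

lemma lext_lshift: "lext \<theta> \<pi> n x \<in> lshift h \<Longrightarrow> m \<le> n \<Longrightarrow> lext \<theta> \<pi> m x \<in> lshift h"
  by (induction n) (auto simp: le_Suc_eq dest: lshift_build)

lemma lext_exists: "\<exists>p. length p = n \<and> lext \<theta> \<pi> n x = p \<frown> x"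
proof (induction n)
  case (Suc n)
  then obtain p where "length p = n" "lext \<theta> \<pi> n x = p \<frown> x" by blast
  then show ?case by (intro exI[of _ "\<theta> ((\<pi> - 1) * Suc n) # p"]) simp
qed simp

lemma period_add_mult:
  assumes "suffix \<pi> \<theta> = \<theta>" shows "\<theta> (i + k * \<pi>) = \<theta> i"
proof (induction k)
  case (Suc k)
  have "\<theta> (\<pi> + (i + k * \<pi>)) = \<theta> (i + k * \<pi>)" using assms by (metis suffix_nth)
  then show ?case using Suc by (simp add: algebra_simps)
qed simp

lemma suffix_period_mult: "suffix \<pi> \<theta> = \<theta> \<Longrightarrow> suffix (i + k * \<pi>) \<theta> = suffix i \<theta>"
  using period_add_mult[of \<pi> \<theta>] by (auto simp: fun_eq_iff) (metis add.assoc add.commute)+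

lemma suffix_period_mod: "suffix \<pi> \<theta> = \<theta> \<Longrightarrow> suffix i \<theta> = suffix (i mod \<pi>) \<theta>"
  using suffix_period_mult[of \<pi> \<theta> "i mod \<pi>" "i div \<pi>"] by simp

text \<open>Modulo \<open>\<pi>\<close>, \<open>(\<pi> - 1) * Suc n + 1\<close> equals
  \<open>(\<pi> - 1) * n\<close>: each step to the left prepends the preceding digit of the periodic
  sequence.\<close>

lemma lext_period:
  assumes "suffix \<pi> \<theta> = \<theta>" "1 \<le> \<pi>" shows "lext \<theta> \<pi> n \<theta> = suffix ((\<pi> - 1) * n) \<theta>"
proof (induction n)
  case (Suc n)
  have "suffix (Suc ((\<pi> - 1) * Suc n)) \<theta> = suffix ((\<pi> - 1) * n + 1 * \<pi>) \<theta>"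
    using assms(2) by (cases \<pi>) (simp_all add: algebra_simps)
  also have "\<dots> = lext \<theta> \<pi> n \<theta>" unfolding Suc by (rule suffix_period_mult[OF assms(1)])
  finally have "lext \<theta> \<pi> n \<theta> = suffix (Suc ((\<pi> - 1) * Suc n)) \<theta>" by simp
  then show ?case by simp
qed simp

lemma lshift_closedD:
  assumes "x \<notin> lshift g" obtains m where "\<And>y. agree m x y \<Longrightarrow> y \<notin> lshift g"
  using lshift_closed[where x=x and g=g] assms by blast

text \<open>
  \<open>lshift gk\<close> is an approximant of \<open>lshift g\<close>, cut out by the prefixes of \<open>g c\<close> of length \<open>l c\<close>. The
  finite set \<open>G\<close> contains all sequences that are ever compared, and \<open>N\<close> digits tell its members
  apart. The bounds with periodic tails are periodic from \<open>\<rho>\<close> on with common period \<open>\<pi>\<close>. A forbidden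
  prefix starts at most \<open>C\<close> digits before the end of \<open>s @ u\<close> for a gap \<open>u\<close> of length \<open>M\<close>, and left extensions
  by at most \<open>D\<close> digits suffice to avoid it.
\<close>

locale approx_gap = lex_gap +
  fixes s :: bword and N \<rho> \<pi> :: nat and gk :: "bool \<Rightarrow> bseq" and l :: "bool \<Rightarrow> nat"
    and C D A :: nat and G :: "bseq set"
  assumes C_def: "C = M + length s"
    and D_def: "D = 2 * C + \<pi> + \<rho> + 1"
    and A_def: "A = 3 * C + \<rho> + \<pi> * \<pi>"
    and G_def: "G = (\<Union>c. \<Union>a\<in>{..A}. {suffix a (g c), True ## suffix a (g c), False ## suffix a (g c)})"
    and s_in: "s \<in> lang (lshift g)" and s_not: "\<And>c. \<not> occurs s (g c)"
    and appr: "\<And>x. x \<in> lshift gk \<longleftrightarrow> x \<in> lshift g \<and>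
      (\<forall>c n. \<not> periodic (g c) \<longrightarrow> \<not> agree (l c) (suffix n x) (g c))"
    and close: "\<And>c. agree N (gk c) (g c)" and N1: "1 \<le> N"
    and trans: "transitive_shift (lshift gk)"
    and sep: "\<And>x y. x \<in> G \<Longrightarrow> y \<in> G \<Longrightarrow> agree N x y \<Longrightarrow> x = y"
    and l_ge: "\<And>c. \<not> periodic (g c) \<Longrightarrow> N + 4 * C + \<rho> + \<pi> + 2 \<le> l c"
    and words: "\<And>w. w \<in> lang (lshift g) \<Longrightarrow> length w \<le> N + 2 * length s + M + D + 2 * C \<Longrightarrow>
      w \<in> lang (lshift gk)"
    and pi1: "1 \<le> \<pi>"
    and per: "\<And>t c. periodic (suffix t (g c)) \<Longrightarrow>
      suffix \<pi> (suffix t (g c)) = suffix t (g c) \<and> periodic (suffix \<rho> (g c))"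
begin

lemma suffix_in_G: "a \<le> A \<Longrightarrow> suffix a (g c) \<in> G"
  and build_in_G: "a \<le> A \<Longrightarrow> e ## suffix a (g c) \<in> G"
  unfolding G_def by (cases e; auto)+

lemma g_in_G: "g c \<in> G"
  using suffix_in_G[of 0] by simp

lemma gk0: "gk c 0 = c"
  using agree_nth[OF close, of 0 c] N1 by simp

text \<open>As \<open>z\<close> is admissible, a violation in \<open>e ## z\<close> starts at its
  first digit; as \<open>gk c\<close> begins with \<open>c\<close>, only the bound with
  \<open>c = e\<close> can be exceeded there.\<close>

lemma build_notin: assumes "z \<in> lshift gk" "e ## z \<notin> lshift gk" shows "dless e (gk e) (e ## z)"
proof -
  obtain c n where n: "dless c (gk c) (suffix n (e ## z))" using assms(2) by (auto simp: lshift_def)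
  have "n = 0"
  proof (rule ccontr)
    assume "n \<noteq> 0"
    then obtain m where "n = Suc m" by (cases n) auto
    then have "suffix n (e ## z) = suffix m z" by (simp add: fun_eq_iff)
    then show False using n assms(1) by (auto simp: lshift_def)
  qed
  then have d: "dless c (gk c) (e ## z)" using n by simp
  then obtain i where i: "agree i (gk c) (e ## z)" "gk c i = (\<not> c)" "(e ## z) i = c"
    by (auto simp: dless_def)
  have "i \<noteq> 0" using i(2) gk0[of c] by metis
  then have "e = c" using agree_nth[OF i(1), of 0] gk0[of c] by simp
  then show ?thesis using d by simp
qed

lemma lshift_upper: "x \<in> lshift h \<Longrightarrow> \<not> dless c (h c) x"
  unfolding lshift_def by (metis (mono_tags, lifting) mem_Collect_eq suffix_0)

lemma gk_sub: "x \<in> lshift gk \<Longrightarrow> x \<in> lshift g"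
  using appr by blast

end

section \<open>A nonperiodic bound with a periodic tail\<close>

locale approx_tail = approx_gap +
  fixes c :: bool and t :: nat and \<theta> :: bseq
  defines "\<theta> \<equiv> suffix t (g c)"
  assumes t: "1 \<le> t" "t \<le> C" and nonper: "\<not> periodic (g c)" and perth: "periodic \<theta>"
begin

text \<open>\<open>pred n\<close> is the digit that the periodic extension puts in front of
  \<open>ext n x\<close>; its negation leaves the orbit of \<open>\<theta>\<close>.\<close>

abbreviation "ext \<equiv> lext \<theta> \<pi>"
abbreviation "pred n \<equiv> \<theta> ((\<pi> - 1) * Suc n)"

lemma theta_period: "suffix \<pi> \<theta> = \<theta>"
  using per perth unfolding \<theta>_def by blast

lemma ext_theta: "ext n \<theta> = suffix ((\<pi> - 1) * n) \<theta>"
  by (rule lext_period[OF theta_period pi1])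

lemma ext_theta_mod: "ext n \<theta> = suffix (((\<pi> - 1) * n) mod \<pi>) \<theta>"
  unfolding ext_theta by (rule suffix_period_mod[OF theta_period])

lemma pred_add: "pred (n + \<pi>) = pred n"
proof -
  have "(\<pi> - 1) * Suc (n + \<pi>) = (\<pi> - 1) * Suc n + (\<pi> - 1) * \<pi>"
    unfolding add_Suc[symmetric] by (rule add_mult_distrib2)
  then show ?thesis using period_add_mult[OF theta_period, of "(\<pi> - 1) * Suc n" "\<pi> - 1"] by metis
qed

lemma ext_theta_add: "ext (n + \<pi>) \<theta> = ext n \<theta>"
  unfolding ext_theta add_mult_distrib2 by (rule suffix_period_mult[OF theta_period])

lemma theta_index: "((\<pi> - 1) * n) mod \<pi> < \<pi>"
  using pi1 by simp

text \<open>Every backward shift of \<open>\<theta>\<close> is one of its first \<open>\<pi>\<close>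
  forward shifts, hence a proper tail of \<open>g c\<close> early enough to be covered by
  \<open>G\<close>.\<close>

lemma ext_theta_suffix_g: "\<exists>a. 1 \<le> a \<and> a \<le> A \<and> ext n \<theta> = suffix a (g c)"
proof (intro exI conjI)
  show "ext n \<theta> = suffix (t + ((\<pi> - 1) * n) mod \<pi>) (g c)"
    unfolding ext_theta_mod by (simp add: \<theta>_def)
  show "t + ((\<pi> - 1) * n) mod \<pi> \<le> A"
  proof -
    have "\<pi> \<le> \<pi> * \<pi>" using pi1 by simp
    then show ?thesis using theta_index[of n] t unfolding A_def by linarith
  qed
qed (use t in simp)

lemma ext_theta_in_G: "ext n \<theta> \<in> G" and build_ext_theta_in_G: "e ## ext n \<theta> \<in> G"
  using ext_theta_suffix_g[of n] suffix_in_G build_in_G by auto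

lemma ext_theta_ne_g: "ext n \<theta> \<noteq> g c"
  using ext_theta_suffix_g[of n] nonper unfolding periodic_def by metis

text \<open>
  \<open>ext n x\<close> and \<open>ext (n + \<pi>) x\<close> deviate from the same shift of \<open>\<theta>\<close> in the same direction, the second
  one later. Moving towards that shift of \<open>\<theta>\<close> is harmless; moving away from it is harmless because
  the bound \<open>g e\<close> differs from \<open>e ## ext n \<theta>\<close> within \<open>N\<close> digits.
\<close>

lemma lext_reduce:
  assumes x: "agree N x \<theta>" and mem: "e ## ext (n + \<pi>) x \<in> lshift gk"
  shows "e ## ext n x \<in> lshift gk"
proof (rule ccontr)
  assume not: "e ## ext n x \<notin> lshift gk"
  have "ext (n + \<pi>) x \<in> lshift gk" using mem lshift_build by blast
  then have "ext n x \<in> lshift gk" by (rule lext_lshift) simp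
  then have big: "dless e (gk e) (e ## ext n x)" using build_notin not by blast
  have "\<not> dless e (gk e) (e ## ext (n + \<pi>) x)" using lshift_upper[OF mem] .
  then have "dless e (e ## ext (n + \<pi>) x) (e ## ext n x)"
    by (rule dless_not_less_trans[OF big])
  then have less: "dless e (ext (n + \<pi>) x) (ext n x)" by simp
  have "x \<noteq> \<theta>" using less ext_theta_add by auto
  define f where "f = (LEAST f. x f \<noteq> \<theta> f)"
  have f: "x f \<noteq> \<theta> f" unfolding f_def by (rule LeastI_ex) (use \<open>x \<noteq> \<theta>\<close> in auto)
  have fa: "agree f x \<theta>" unfolding agree_def f_def using not_less_Least by blast
  have a1: "agree (f + n) (ext n x) (ext n \<theta>)" by (rule agree_lext[OF fa])
  have a2: "agree (f + (n + \<pi>)) (ext (n + \<pi>) x) (ext n \<theta>)"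
    using agree_lext[OF fa, where n = "n + \<pi>" and \<theta> = \<theta> and \<pi> = \<pi>] unfolding ext_theta_add .
  have i1: "ext n x (f + n) = x f" "ext n \<theta> (f + n) = \<theta> f"
    using lext_nth[of \<theta> \<pi> n _ f] by (simp_all add: add.commute)
  have i2: "ext (n + \<pi>) x (f + (n + \<pi>)) = x f" "ext n \<theta> (f + (n + \<pi>)) = \<theta> f"
    using lext_nth[of \<theta> \<pi> "n + \<pi>" _ f] ext_theta_add[of n] by (metis add.commute)+
  \<comment> \<open>Otherwise both extensions leave the same shift of \<open>\<theta>\<close>
    against direction \<open>e\<close>, and the later departure puts
    \<open>ext (n + \<pi>) x\<close> beyond \<open>ext n x\<close>, contrary to
    \<open>less\<close>.\<close>
  have "x f = e"
  proof (rule ccontr)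
    assume "x f \<noteq> e"
    then have th: "x f = (\<not> e)" "\<theta> f = e" using f by auto
    have "ext (n + \<pi>) x (f + n) = e"
      using agree_nth[OF a2, of "f + n"] pi1 i1 th by simp
    moreover have "agree (f + n) (ext n x) (ext (n + \<pi>) x)"
      using a1 agree_sym[OF agree_mono[OF a2]] agree_trans by (metis add.assoc le_add1)
    ultimately have "dless e (ext n x) (ext (n + \<pi>) x)"
      using i1 th by (intro dlessI[of "f + n"]) auto
    then show False using less dless_trans dless_irrefl by blast
  qed
  then have "dless e (ext n \<theta>) (ext (n + \<pi>) x)"
    using agree_sym[OF a2] i2 f by (intro dlessI[of "f + (n + \<pi>)"]) auto
  then have th: "dless e (e ## ext n \<theta>) (e ## ext (n + \<pi>) x)" by simp
  have up: "\<not> dless e (g e) (e ## ext (n + \<pi>) x)" using lshift_upper[OF gk_sub[OF mem]] .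
  have "dless e (e ## ext n \<theta>) (g e)"
    using th up by (rule not_less_dless_trans)
  then obtain d where d: "agree d (e ## ext n \<theta>) (g e)" "(e ## ext n \<theta>) d = (\<not> e)" "g e d = e"
    by (auto simp: dless_def)
  \<comment> \<open>Agreement on \<open>N\<close> digits would mean equality, by separation in
    \<open>G\<close>.\<close>
  have "d < N"
  proof (rule ccontr)
    assume "\<not> d < N"
    then have "e ## ext n \<theta> = g e"
      using sep[OF build_ext_theta_in_G g_in_G] agree_mono[OF d(1)] by simp
    then show False using d by simp
  qed
  have cl: "agree (Suc (N + n)) (e ## ext n x) (e ## ext n \<theta>)"
    by (intro agree_build agree_lext x)
  have "dless e (e ## ext n x) (gk e)"
  proof (rule dlessI[of d])
    show "agree d (e ## ext n x) (gk e)"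
      using agree_mono[OF cl, of d] d(1) agree_mono[OF close, of d e] \<open>d < N\<close>
      by (simp add: agree_def)
    show "(e ## ext n x) d = (\<not> e)" using agree_nth[OF cl, of d] \<open>d < N\<close> d by simp
    show "gk e d = e" using agree_nth[OF close, of d e] \<open>d < N\<close> d by simp
  qed
  then show False using big dless_trans dless_irrefl by blast
qed

text \<open>\<open>lext_reduce\<close> carries the exclusion of the nonperiodic digit from the first
  period to every \<open>n\<close>, so each digit added on the left is the periodic one.\<close>

lemma forced_left_extension:
  assumes x: "agree N x \<theta>" "\<And>n. n < \<pi> \<Longrightarrow> (\<not> pred n) ## ext n x \<notin> lshift gk"
  shows "q \<frown> x \<in> lshift gk \<Longrightarrow> q \<frown> x = ext (length q) x"
proof (induction q)
  case (Cons d q)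
  have no: "(\<not> pred n) ## ext n x \<notin> lshift gk" for n
  proof (induction n rule: less_induct)
    case (less n)
    show ?case
    proof (cases "n < \<pi>")
      case False
      then obtain m where m: "n = m + \<pi>" by (metis add.commute le_add_diff_inverse not_less)
      show ?thesis
      proof
        assume "(\<not> pred n) ## ext n x \<in> lshift gk"
        then have "(\<not> pred m) ## ext m x \<in> lshift gk"
          using lext_reduce[OF x(1)] unfolding m pred_add by blast
        then show False using less[of m] m pi1 by simp
      qed
    qed (use x in blast)
  qed
  have "d ## q \<frown> x \<in> lshift gk" using Cons.prems by simp
  then have "q \<frown> x \<in> lshift gk" by (rule lshift_build)
  then have q: "q \<frown> x = ext (length q) x" by (rule Cons.IH)
  have "d = pred (length q)"
  proof (rule ccontr)
    assume "d \<noteq> pred (length q)"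
    then have "d = (\<not> pred (length q))" by simp
    then show False using no[of "length q"] \<open>d ## q \<frown> x \<in> lshift gk\<close> unfolding q by simp
  qed
  then show ?case using q by simp
qed simp

text \<open>If no other digit could enter within one period, the same would hold for points near
  \<open>x\<close>. Transitivity leads from a prefix of \<open>g c\<close> to such a point,
  necessarily along a periodic path, so \<open>g c\<close> would be a shift of
  \<open>\<theta>\<close> and hence periodic.\<close>

lemma entrance:
  assumes x: "agree N x \<theta>" "x \<in> lshift gk"
  shows "\<exists>n<\<pi>. (\<not> pred n) ## ext n x \<in> lshift gk"
proof (rule ccontr)
  assume "\<not> ?thesis"
  then have no: "\<And>n. n < \<pi> \<Longrightarrow> (\<not> pred n) ## ext n x \<notin> lshift gk" by blast
  have "\<exists>m. \<forall>y. agree m ((\<not> pred n) ## ext n x) y \<longrightarrow> y \<notin> lshift gk" if "n < \<pi>" for n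
    using lshift_closedD[OF no[OF that]] by metis
  then obtain m where m: "\<And>n y. n < \<pi> \<Longrightarrow> agree (m n) ((\<not> pred n) ## ext n x) y \<Longrightarrow> y \<notin> lshift gk"
    by metis
  \<comment> \<open>\<open>k\<close> digits of \<open>x\<close> secure both the closeness to
    \<open>\<theta>\<close> and all \<open>\<pi>\<close> exclusions.\<close>
  define k where "k = max N (Max (m ` {..<\<pi>}))"
  have k: "N \<le> k" "n < \<pi> \<Longrightarrow> m n \<le> k" for n
    unfolding k_def by (auto intro: Max_ge max.coboundedI2)
  have pin: "prefix N (g c) \<in> lang (lshift gk)"
    using words[OF prefix_g_in_lang] N1 by simp
  have pix: "prefix k x \<in> lang (lshift gk)"
    unfolding lang_iff using x(2) k N1 by (metis prefix_suffix subsequence_empty le_zero_eq not_one_le_zero)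
  obtain u where "prefix N (g c) @ u @ prefix k x \<in> lang (lshift gk)"
    using trans pin pix unfolding transitive_shift_def by blast
  then obtain y where y: "(prefix N (g c) @ u @ prefix k x) \<frown> y \<in> lshift gk" unfolding lang_iff by blast
  define x' where "x' = prefix k x \<frown> y"
  define q where "q = prefix N (g c) @ u"
  have qx: "q \<frown> x' \<in> lshift gk" using y unfolding q_def x'_def conc_conc append_assoc .
  have ag: "agree k x x'" unfolding x'_def by (rule agree_prefix_conc)
  have x': "agree N x' \<theta>" by (rule agree_trans[OF agree_sym[OF agree_mono[OF ag k(1)]] x(1)])
  have "q \<frown> x' = ext (length q) x'"
  proof (rule forced_left_extension[OF x' _ qx])
    fix n assume n: "n < \<pi>"
    have "agree (k + n) (ext n x) (ext n x')" by (rule agree_lext[OF ag])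
    then have "agree (m n) ((\<not> pred n) ## ext n x) ((\<not> pred n) ## ext n x')"
      by (intro agree_build2) (erule agree_mono, use k(2)[OF n] in simp)
    then show "(\<not> pred n) ## ext n x' \<notin> lshift gk" by (rule m[OF n])
  qed
  moreover have "agree N (g c) (q \<frown> x')"
    by (simp add: q_def agree_def nth_append conc_def)
  moreover have "agree N (ext (length q) x') (ext (length q) \<theta>)"
    using agree_lext[OF x'] agree_mono by (metis le_add1)
  ultimately have "agree N (g c) (ext (length q) \<theta>)" using agree_trans by metis
  then have "g c = ext (length q) \<theta>" using sep g_in_G ext_theta_in_G by blast
  then show False using ext_theta_ne_g by metis
qed

end

section \<open>Bridges from \<open>s\<close> to a point\<close>

context approx_gap
begin

text \<open>Prepending a word with suffix \<open>prefix t (g c)\<close> to a bad sequence completes a forbidden prefix.\<close>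

definition bad :: "bool \<Rightarrow> nat \<Rightarrow> bseq \<Rightarrow> bool"
  where "bad c t z \<longleftrightarrow> \<not> periodic (g c) \<and> 1 \<le> t \<and> t \<le> C \<and> agree (l c - t) z (suffix t (g c))"

lemma left_word: "z \<in> lshift gk \<Longrightarrow> \<exists>p. length p = n \<and> p \<frown> z \<in> lshift gk"
  using transitive_left_extendable_word[OF trans] by blast

text \<open>Both assumptions place \<open>z\<close> along \<open>g c\<close>, at positions
  \<open>t\<close> and \<open>t' + length p\<close>. These differ since
  \<open>t \<le> C \<le> length p\<close>, so separation makes the tail at \<open>t\<close> a proper
  shift of itself.\<close>

lemma bad_twice:
  assumes "bad c t z" "bad c t' (p \<frown> z)" "C \<le> length p" "length p \<le> 2 * C"
  shows "periodic (suffix t (g c))"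
proof -
  have t: "1 \<le> t" "t \<le> C" "1 \<le> t'" "t' \<le> C" and np: "\<not> periodic (g c)"
    using assms unfolding bad_def by auto
  have l: "N + 4 * C \<le> l c" using l_ge[OF np] by simp
  have "agree N z (suffix t (g c))"
    by (rule agree_mono[of "l c - t"]) (use assms(1) l t in \<open>auto simp: bad_def\<close>)
  moreover have "agree (l c - t' - length p) z (suffix (t' + length p) (g c))"
    using agree_suffix[of "l c - t'" "p \<frown> z" "suffix t' (g c)" "length p"] assms(2)
    unfolding bad_def by simp
  then have "agree N z (suffix (t' + length p) (g c))"
    by (rule agree_mono) (use assms(4) l t in linarith)
  ultimately have "agree N (suffix t (g c)) (suffix (t' + length p) (g c))"
    using agree_sym agree_trans by blast
  then have "suffix t (g c) = suffix (t' + length p) (g c)"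
    by (rule sep[rotated 2]; intro suffix_in_G) (use t assms(4) in \<open>auto simp: A_def\<close>)
  moreover have "t + (t' + length p - t) = t' + length p" using t assms(3) by linarith
  ultimately have "suffix (t' + length p - t) (suffix t (g c)) = suffix t (g c)"
    unfolding suffix_suffix by metis
  moreover have "1 \<le> t' + length p - t" using t assms(3) by linarith
  ultimately show ?thesis unfolding periodic_def by blast
qed

lemma good_left_extension:
  assumes v: "v \<in> lshift gk"
  shows "\<exists>p. length p \<le> D \<and> p \<frown> v \<in> lshift gk \<and> (\<forall>c t. \<not> bad c t (p \<frown> v))"
proof (rule ccontr)
  assume contra: "\<not> ?thesis"
  then have bad: "\<exists>c t. bad c t (p \<frown> v)" if "length p \<le> D" "p \<frown> v \<in> lshift gk" for p
    using that by blast
  \<comment> \<open>Three nested extensions and two bounds: two of the extensions are bad for the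
    same bound, whose tail is then periodic.\<close>
  obtain p1 where p1: "length p1 = C" "p1 \<frown> v \<in> lshift gk" using left_word[OF v] by blast
  obtain p2 where p2: "length p2 = C" "p2 \<frown> p1 \<frown> v \<in> lshift gk" using left_word[OF p1(2)] by blast
  have CD: "2 * C \<le> D" "C \<le> D" unfolding D_def by auto
  obtain c0 t0 where b0: "bad c0 t0 ([] \<frown> v)" using bad[of "[]"] v by auto
  obtain c1 t1 where b1: "bad c1 t1 (p1 \<frown> v)" using bad[of p1] p1 CD by auto
  obtain c2 t2 where b2: "bad c2 t2 (p2 \<frown> p1 \<frown> v)" using bad[of "p2 @ p1"] p1 p2 CD by auto
  have "\<exists>p c t. length p \<le> C \<and> p \<frown> v \<in> lshift gk \<and> bad c t (p \<frown> v) \<and> periodic (suffix t (g c))"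
  proof -
    consider "c0 = c1" | "c0 = c2" | "c1 = c2" by auto
    then show ?thesis
    proof cases
      case 1
      then have "periodic (suffix t0 (g c0))" using bad_twice[of c0 t0 v t1 p1] b0 b1 p1 by auto
      then show ?thesis using b0 v by (metis conc_empty list.size(3) zero_le)
    next
      case 2
      then have "periodic (suffix t0 (g c0))" using bad_twice[of c0 t0 v t2 "p2 @ p1"] b0 b2 p1 p2 by auto
      then show ?thesis using b0 v by (metis conc_empty list.size(3) zero_le)
    next
      case 3
      then have "periodic (suffix t1 (g c1))"
        using bad_twice[of c1 t1 "p1 \<frown> v" t2 p2] b1 b2 p1 p2 by auto
      then show ?thesis using b1 p1 by (metis order_refl)
    qed
  qed
  then obtain p c t where p: "length p \<le> C" "p \<frown> v \<in> lshift gk" "bad c t (p \<frown> v)"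
    "periodic (suffix t (g c))" by blast
  have t: "1 \<le> t" "t \<le> C" and np: "\<not> periodic (g c)" using p(3) unfolding bad_def by auto
  interpret tail: approx_tail g M s N \<rho> \<pi> gk l C D A G c t "suffix t (g c)"
    by (unfold_locales) (use t np p(4) in auto)
  define x where "x = p \<frown> v"
  have lc: "N + 4 * C + \<rho> + \<pi> + 2 \<le> l c" by (rule l_ge[OF np])
  have ax: "agree (l c - t) x (suffix t (g c))" using p(3) unfolding bad_def x_def by blast
  have axN: "agree N x (suffix t (g c))"
    by (rule agree_mono[OF ax]) (use lc t in linarith)
  \<comment> \<open>Leave the periodic orbit through a nonperiodic digit, then go
    \<open>\<rho>\<close> digits further left, so that badness would compare this digit with one of
    \<open>g c'\<close> beyond position \<open>\<rho>\<close>.\<close>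
  obtain n where n: "n < \<pi>" "(\<not> tail.pred n) ## tail.ext n x \<in> lshift gk"
    using tail.entrance[OF axN] p(2) unfolding x_def by blast
  obtain q where q: "length q = \<rho>" "q \<frown> ((\<not> tail.pred n) ## tail.ext n x) \<in> lshift gk"
    using left_word[OF n(2)] by blast
  obtain r where r: "length r = n" "tail.ext n x = r \<frown> x" using lext_exists by blast
  let ?p = "q @ (\<not> tail.pred n) # r @ p"
  have z: "?p \<frown> v = q \<frown> ((\<not> tail.pred n) ## tail.ext n x)" by (simp add: r(2)[unfolded x_def] x_def)
  have "length ?p \<le> D" using q(1) r(1) p(1) n(1) unfolding D_def by simp
  then obtain c' t' where b: "bad c' t' (q \<frown> ((\<not> tail.pred n) ## tail.ext n x))"
    using bad[of ?p] q(2) unfolding z by blast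
  have t': "1 \<le> t'" "t' \<le> C" and np': "\<not> periodic (g c')" using b unfolding bad_def by auto
  have lc': "N + 4 * C + \<rho> + \<pi> + 2 \<le> l c'" by (rule l_ge[OF np'])
  have "agree (l c' - t' - \<rho>) ((\<not> tail.pred n) ## tail.ext n x) (suffix (t' + \<rho>) (g c'))"
    using agree_suffix[of "l c' - t'" "q \<frown> ((\<not> tail.pred n) ## tail.ext n x)" "suffix t' (g c')" \<rho>] b q(1)
    unfolding bad_def by (metis suffix_conc_length suffix_suffix)
  then have 1: "agree N ((\<not> tail.pred n) ## tail.ext n x) (suffix (t' + \<rho>) (g c'))"
    by (rule agree_mono) (use lc' t' in linarith)
  have "agree (N + n) (tail.ext n x) (tail.ext n (suffix t (g c)))" by (rule agree_lext[OF axN])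
  then have 2: "agree N ((\<not> tail.pred n) ## tail.ext n x) ((\<not> tail.pred n) ## tail.ext n (suffix t (g c)))"
    by (intro agree_build2) (erule agree_mono, simp)
  have eq: "suffix (t' + \<rho>) (g c') = (\<not> tail.pred n) ## tail.ext n (suffix t (g c))"
  proof (rule sep)
    show "suffix (t' + \<rho>) (g c') \<in> G" by (rule suffix_in_G) (use t' in \<open>auto simp: A_def\<close>)
    show "(\<not> tail.pred n) ## tail.ext n (suffix t (g c)) \<in> G" by (rule tail.build_ext_theta_in_G)
    show "agree N (suffix (t' + \<rho>) (g c')) ((\<not> tail.pred n) ## tail.ext n (suffix t (g c)))"
      using 1 2 agree_sym agree_trans by blast
  qed
  define \<theta>' where "\<theta>' = tail.ext n (suffix t (g c))"
  have \<theta>': "\<theta>' = suffix ((\<pi> - 1) * n) (suffix t (g c))" unfolding \<theta>'_def by (rule tail.ext_theta)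
  have th_per: "suffix \<pi> \<theta>' = \<theta>'"
    unfolding \<theta>' using tail.theta_period by (metis add.commute suffix_suffix)
  have "suffix 1 (suffix (t' + \<rho>) (g c')) = \<theta>'" unfolding eq \<theta>'_def by (simp add: fun_eq_iff)
  then have s1: "suffix (t' + \<rho> + 1) (g c') = \<theta>'" by simp
  then have "periodic (suffix (t' + \<rho> + 1) (g c'))" using th_per pi1 unfolding periodic_def by auto
  \<comment> \<open>One tail of \<open>g c'\<close> is periodic, so all tails from
    \<open>\<rho>\<close> on have period \<open>\<pi>\<close>. The nonperiodic digit would recur
    \<open>\<pi>\<close> places later, where \<open>\<theta>'\<close> has
    \<open>tail.pred n\<close>.\<close>
  then have per_rho: "periodic (suffix \<rho> (g c'))" using per by blast
  then have "suffix \<pi> (suffix \<rho> (g c')) = suffix \<rho> (g c')" using per by blast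
  then have "suffix \<pi> (suffix (t' + \<rho>) (g c')) = suffix (t' + \<rho>) (g c')"
    by (metis add.commute suffix_suffix)
  then have "((\<not> tail.pred n) ## \<theta>') \<pi> = (\<not> tail.pred n)"
    unfolding eq \<theta>'_def[symmetric] by (metis suffix_nth add.right_neutral build.simps(1))
  moreover have "((\<not> tail.pred n) ## \<theta>') \<pi> = \<theta>' (\<pi> - 1)" using pi1 by (cases \<pi>) auto
  moreover have "\<theta>' (\<pi> - 1) = tail.pred n" unfolding \<theta>' suffix_nth mult_Suc_right by (metis add.commute)
  ultimately show False by simp
qed

text \<open>Specification and compactness give \<open>u\<close> in the limit shift. A forbidden
  prefix cannot start inside \<open>z\<close>, and one starting at most \<open>C\<close> digits
  earlier would make \<open>z\<close> bad.\<close>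

lemma bridge_right:
  assumes z: "z \<in> lshift gk" and good: "\<And>c t. \<not> bad c t z"
  shows "\<exists>u. length u = M \<and> s \<frown> u \<frown> z \<in> lshift gk"
proof -
  have "\<exists>u. length u = M \<and> s \<frown> u \<frown> z \<in> lshift g"
  proof (rule lshift_conc_compact)
    fix n
    have "prefix (Suc n) z \<in> lang (lshift g)"
      unfolding lang_iff using gk_sub[OF z] by (metis prefix_suffix subsequence_empty not_less_eq_eq zero_le)
    then obtain u where u: "length u = M" "s @ u @ prefix (Suc n) z \<in> lang (lshift g)"
      using spec s_in by blast
    then obtain y where "(s @ u @ prefix n z @ [z n]) \<frown> y \<in> lshift g" unfolding lang_iff by auto
    then have "s \<frown> u \<frown> prefix n z \<frown> ([z n] \<frown> y) \<in> lshift g" unfolding conc_conc append_assoc .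
    then show "\<exists>u y. length u = M \<and> s \<frown> u \<frown> prefix n z \<frown> y \<in> lshift g" using u(1) by blast
  qed
  then obtain u where u: "length u = M" "s \<frown> u \<frown> z \<in> lshift g" by blast
  have "s \<frown> u \<frown> z \<in> lshift gk"
    unfolding appr
  proof (intro conjI allI impI notI)
    fix c n assume np: "\<not> periodic (g c)" and ag: "agree (l c) (suffix n (s \<frown> u \<frown> z)) (g c)"
    have len: "length (s @ u) = C" using u(1) unfolding C_def by simp
    show False
    proof (cases "n < C")
      case True
      have "agree (l c - (C - n)) (suffix (C - n) (suffix n (s \<frown> u \<frown> z))) (suffix (C - n) (g c))"
        by (rule agree_suffix[OF ag])
      moreover have "suffix (C - n) (suffix n (s \<frown> u \<frown> z)) = z"
        using True suffix_conc_length[of "s @ u" z] len by simp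
      ultimately have "bad c (C - n) z" unfolding bad_def using np True by simp
      then show False using good by blast
    next
      case False
      then have "suffix n (s \<frown> u \<frown> z) = suffix (n - C) z"
        using suffix_conc_snd[of "s @ u" n z] len by simp
      then show False using ag np z unfolding appr by metis
    qed
  qed (rule u(2))
  then show ?thesis using u(1) by blast
qed

section \<open>Bridges from a word to \<open>s\<close>\<close>

text \<open>The length \<open>l c\<close> prefix of \<open>g c\<close> starts at \<open>a\<close>, before the cut \<open>m\<close>, and ends shortly after it.\<close>

definition straddles :: "bool \<Rightarrow> nat \<Rightarrow> nat \<Rightarrow> bseq \<Rightarrow> bool"
  where "straddles c a m x \<longleftrightarrow> \<not> periodic (g c) \<and> a < m \<and> m < a + l c \<and> a + l c < m + C \<and>
    agree (m - a) (suffix a x) (g c)"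

text \<open>The second start comes after the first, by at most \<open>3 * C\<close> digits, and
  still \<open>N\<close> digits before the cut \<open>m\<close>. There \<open>g c\<close> agrees
  with a proper shift of itself, which makes it periodic.\<close>

lemma straddles_twice:
  assumes "straddles c a m x" "straddles c b n x" "m + C \<le> n" "n \<le> m + 2 * C"
  shows False
proof -
  have np: "\<not> periodic (g c)" using assms unfolding straddles_def by blast
  have l: "N + 4 * C \<le> l c" using l_ge[OF np] by simp
  have ab: "a < b" "b - a \<le> 3 * C" "b + N \<le> m"
    using assms l unfolding straddles_def by linarith+
  have "agree (m - b) (suffix b x) (suffix (b - a) (g c))"
    using agree_suffix[of "m - a" "suffix a x" "g c" "b - a"] assms(1) ab unfolding straddles_def by simp
  then have "agree N (suffix b x) (suffix (b - a) (g c))" by (rule agree_mono) (use ab in linarith)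
  moreover have "agree N (suffix b x) (g c)"
    by (rule agree_mono[of "n - b"]) (use assms ab in \<open>auto simp: straddles_def\<close>)
  ultimately have "agree N (suffix (b - a) (g c)) (g c)" using agree_sym agree_trans by blast
  then have "suffix (b - a) (g c) = g c"
    by (rule sep[rotated 2]) (use ab suffix_in_G[of "b - a" c] g_in_G in \<open>auto simp: A_def\<close>)
  then show False using np ab unfolding periodic_def by (metis One_nat_def Suc_leI zero_less_diff)
qed

text \<open>Specification bridges to \<open>s\<close> in the limit shift, and synchronization
  exchanges what follows \<open>s\<close>. A forbidden prefix in the result neither ends before the
  cut nor starts in \<open>s \<frown> y\<close>, and it cannot contain \<open>s\<close>; so it
  straddles the cut.\<close>

lemma bridge_left_or_straddles:
  assumes w: "w \<frown> x \<in> lshift gk" "w \<noteq> []" and y: "s \<frown> y \<in> lshift gk"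
  shows "(\<exists>u. length u = M \<and> w \<frown> prefix n x \<frown> u \<frown> s \<frown> y \<in> lshift gk) \<or>
    (\<exists>c a. straddles c a (length w + n) (w \<frown> x))"
proof -
  have "w \<frown> x = (w @ prefix n x) \<frown> suffix n x" using conc_conc[of w "prefix n x" "suffix n x"] by simp
  then have "w @ prefix n x \<in> lang (lshift g)"
    unfolding lang_iff using gk_sub[OF w(1)] w(2) by (metis append_is_Nil_conv)
  then obtain u where u0: "length u = M" "(w @ prefix n x) @ u @ s \<in> lang (lshift g)"
    using spec[OF _ s_in] by blast
  obtain y' where u: "length u = M" "((w @ prefix n x) @ u @ s) \<frown> y' \<in> lshift g"
    using u0 unfolding lang_iff by blast
  define p where "p = w @ prefix n x @ u"
  have "p \<frown> s \<frown> y' \<in> lshift g" using u(2) unfolding p_def conc_conc append_assoc .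
  then have mem: "p \<frown> s \<frown> y \<in> lshift g" by (rule lshift_synchronize[OF s_not _ gk_sub[OF y]])
  have pe: "p \<frown> s \<frown> y = w \<frown> prefix n x \<frown> u \<frown> s \<frown> y" unfolding p_def conc_conc append_assoc ..
  have lp: "length p = length w + n + M" using u(1) unfolding p_def by simp
  show ?thesis
  proof (cases "p \<frown> s \<frown> y \<in> lshift gk")
    case True
    then show ?thesis using u(1) unfolding pe by blast
  next
    case False
    then obtain c a where np: "\<not> periodic (g c)" and ag: "agree (l c) (suffix a (p \<frown> s \<frown> y)) (g c)"
      using mem unfolding appr by blast
    have l: "C < l c" using l_ge[OF np] by simp
    have same: "agree (length w + n) (p \<frown> s \<frown> y) (w \<frown> x)"
      unfolding p_def agree_def by (auto simp: nth_append conc_def)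
    have a1: "\<not> (a + l c \<le> length w + n)"
    proof
      assume le: "a + l c \<le> length w + n"
      have "agree (l c) (suffix a (p \<frown> s \<frown> y)) (suffix a (w \<frown> x))"
        by (rule agree_mono[OF agree_suffix[OF same]]) (use le in linarith)
      then have "agree (l c) (suffix a (w \<frown> x)) (g c)" using ag agree_sym agree_trans by blast
      then show False using np w(1) unfolding appr by blast
    qed
    have a2: "a < length p"
    proof (rule ccontr)
      assume "\<not> a < length p"
      then have "suffix a (p \<frown> s \<frown> y) = suffix (a - length p) (s \<frown> y)"
        using suffix_conc_snd[of p a "s \<frown> y"] by simp
      then show False using ag np y unfolding appr by metis
    qed
    have a3: "a + l c < length p + length s"
    proof (rule ccontr)
      assume "\<not> a + l c < length p + length s"
      have "g c (length p - a + j) = s ! j" if j: "j < length s" for j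
      proof -
        have "g c (length p - a + j) = (p \<frown> s \<frown> y) (a + (length p - a + j))"
          using agree_nth[OF ag, of "length p - a + j"] \<open>\<not> a + l c < _\<close> j a2 by (simp del: conc_conc suffix_conc_fst)
        also have "a + (length p - a + j) = length p + j" using a2 by simp
        finally show ?thesis using conc_conc_nth[OF j] by metis
      qed
      then have "occurs s (g c)" unfolding occurs_iff by blast
      then show False using s_not by blast
    qed
    have "agree (length w + n - a) (suffix a (w \<frown> x)) (g c)"
    proof -
      have "agree (length w + n - a) (suffix a (w \<frown> x)) (suffix a (p \<frown> s \<frown> y))"
        by (rule agree_suffix[OF agree_sym[OF same]])
      moreover have "agree (length w + n - a) (suffix a (p \<frown> s \<frown> y)) (g c)"
        by (rule agree_mono[OF ag]) (use a1 in linarith)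
      ultimately show ?thesis by (rule agree_trans)
    qed
    moreover have "a + l c < length w + n + C" using a3 lp unfolding C_def by simp
    ultimately have "straddles c a (length w + n) (w \<frown> x)"
      unfolding straddles_def using np a1 l by auto
    then show ?thesis by blast
  qed
qed

text \<open>Of the cuts \<open>0\<close>, \<open>C\<close> and \<open>2 * C\<close> digits into
  \<open>x\<close>, two would be straddled for the same bound.\<close>

lemma bridge_left:
  assumes w: "w \<frown> x \<in> lshift gk" "w \<noteq> []" and y: "s \<frown> y \<in> lshift gk"
  shows "\<exists>n u. n \<le> 2 * C \<and> length u = M \<and> w \<frown> prefix n x \<frown> u \<frown> s \<frown> y \<in> lshift gk"
proof (rule ccontr)
  assume no: "\<not> ?thesis"
  have st: "\<exists>c a. straddles c a (length w + n) (w \<frown> x)" if "n \<le> 2 * C" for n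
    using bridge_left_or_straddles[OF assms, of n] no that by blast
  obtain c0 a0 where s0: "straddles c0 a0 (length w + 0) (w \<frown> x)" using st[of 0] by blast
  obtain c1 a1 where s1: "straddles c1 a1 (length w + C) (w \<frown> x)" using st[of C] by auto
  obtain c2 a2 where s2: "straddles c2 a2 (length w + 2 * C) (w \<frown> x)" using st[of "2 * C"] by blast
  consider "c0 = c1" | "c0 = c2" | "c1 = c2" by auto
  then show False
  proof cases
    case 1
    then show ?thesis using straddles_twice[of c1 a0 "length w + 0" "w \<frown> x" a1 "length w + C"] s0 s1 by simp
  next
    case 2
    then show ?thesis using straddles_twice[of c2 a0 "length w + 0" "w \<frown> x" a2 "length w + 2 * C"] s0 s2 by simp
  next
    case 3
    then show ?thesis using straddles_twice[of c2 a1 "length w + C" "w \<frown> x" a2 "length w + 2 * C"] s1 s2 by simp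
  qed
qed

section \<open>Joining the bridges with constant total length\<close>

lemma s_ne: "s \<noteq> []"
  using s_in unfolding lang_iff by blast

lemma synchronize:
  assumes "p \<frown> s \<frown> y' \<in> lshift gk" "s \<frown> y \<in> lshift gk" shows "p \<frown> s \<frown> y \<in> lshift gk"
  unfolding appr
proof (intro conjI allI impI notI)
  show "p \<frown> s \<frown> y \<in> lshift g"
    by (rule lshift_synchronize[OF s_not gk_sub[OF assms(1)] gk_sub[OF assms(2)]])
next
  fix c a assume np: "\<not> periodic (g c)" and ag: "agree (l c) (suffix a (p \<frown> s \<frown> y)) (g c)"
  have a2: "a < length p"
  proof (rule ccontr)
    assume "\<not> a < length p"
    then have "suffix a (p \<frown> s \<frown> y) = suffix (a - length p) (s \<frown> y)"
      using suffix_conc_snd[of p a "s \<frown> y"] by simp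
    then show False using ag np assms(2) unfolding appr by metis
  qed
  show False
  proof (cases "a + l c \<le> length p + length s")
    case True
    have "agree (length p + length s) (p \<frown> s \<frown> y') (p \<frown> s \<frown> y)"
      by (simp add: agree_def)
    then have "agree (length p + length s - a) (suffix a (p \<frown> s \<frown> y')) (suffix a (p \<frown> s \<frown> y))"
      by (rule agree_suffix)
    then have "agree (l c) (suffix a (p \<frown> s \<frown> y')) (suffix a (p \<frown> s \<frown> y))"
      by (rule agree_mono) (use True in linarith)
    then have "agree (l c) (suffix a (p \<frown> s \<frown> y')) (g c)" using ag agree_trans by blast
    then show False using np assms(1) unfolding appr by blast
  next
    case False
    have "g c (length p - a + j) = s ! j" if j: "j < length s" for j
    proof -
      have "g c (length p - a + j) = (p \<frown> s \<frown> y) (a + (length p - a + j))"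
        using agree_nth[OF ag, of "length p - a + j"] False j a2 by (simp del: conc_conc suffix_conc_fst)
      also have "a + (length p - a + j) = length p + j" using a2 by simp
      finally show ?thesis using conc_conc_nth[OF j] by metis
    qed
    then have "occurs s (g c)" unfolding occurs_iff by blast
    then show False using s_not by blast
  qed
qed

text \<open>A left extension \<open>q\<close> of length \<open>r\<close> adjusts the length; the
  bridge found in the limit shift is part of a word short enough to belong to the
  approximant.\<close>

lemma padding:
  assumes "r \<le> 2 * C + D"
  shows "\<exists>u y. length u = M + r \<and> s \<frown> u \<frown> s \<frown> y \<in> lshift gk"
proof -
  obtain y where y: "s \<frown> y \<in> lshift gk" using words[OF s_in] unfolding lang_iff by auto
  obtain q where q: "length q = r" "q \<frown> s \<frown> y \<in> lshift gk" using left_word[OF y] by blast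
  then have "q @ s \<in> lang (lshift g)"
    unfolding lang_iff using s_ne gk_sub[OF q(2)] unfolding conc_conc by blast
  then obtain u where u: "length u = M" "s @ u @ q @ s \<in> lang (lshift g)" using spec s_in by blast
  then have "s @ u @ q @ s \<in> lang (lshift gk)"
    by (rule_tac words) (use q(1) u(1) assms in simp_all)
  then obtain y where "(s @ u @ q @ s) \<frown> y \<in> lshift gk" unfolding lang_iff by blast
  then have "s \<frown> (u @ q) \<frown> s \<frown> y \<in> lshift gk" unfolding conc_conc append_assoc .
  then show ?thesis using u(1) q(1) by (intro exI[of _ "u @ q"]) auto
qed

text \<open>The word \<open>u2\<close> between two copies of \<open>s\<close> compensates the
  variable lengths of \<open>prefix n x\<close> and \<open>p\<close>.\<close>

lemma uniform_gap:
  assumes "w \<in> lang (lshift gk)" "v \<in> lang (lshift gk)"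
  shows "\<exists>u. length u = 3 * M + 2 * length s + 2 * C + D \<and> w @ u @ v \<in> lang (lshift gk)"
proof -
  obtain x z where w: "w \<noteq> []" "w \<frown> x \<in> lshift gk" and v: "v \<noteq> []" "v \<frown> z \<in> lshift gk"
    using assms unfolding lang_iff by blast
  obtain p where p: "length p \<le> D" "p \<frown> v \<frown> z \<in> lshift gk" "\<And>c t. \<not> bad c t (p \<frown> v \<frown> z)"
    using good_left_extension[OF v(2)] by blast
  obtain u3 where u3: "length u3 = M" "s \<frown> u3 \<frown> p \<frown> v \<frown> z \<in> lshift gk"
    using bridge_right[OF p(2,3)] by blast
  obtain n u1 where u1: "n \<le> 2 * C" "length u1 = M"
    "w \<frown> prefix n x \<frown> u1 \<frown> s \<frown> u3 \<frown> p \<frown> v \<frown> z \<in> lshift gk"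
    using bridge_left[OF w(2,1) u3(2)] by blast
  obtain u2 y where u2: "length u2 = M + (2 * C - n + (D - length p))" "s \<frown> u2 \<frown> s \<frown> y \<in> lshift gk"
    using padding[of "2 * C - n + (D - length p)"] by fastforce
  have "(s @ u2) \<frown> s \<frown> y \<in> lshift gk" using u2(2) unfolding conc_conc append_assoc .
  from synchronize[OF this u3(2)]
  have "s \<frown> u2 \<frown> s \<frown> u3 \<frown> p \<frown> v \<frown> z \<in> lshift gk" unfolding conc_conc append_assoc .
  moreover have "(w @ prefix n x @ u1) \<frown> s \<frown> u3 \<frown> p \<frown> v \<frown> z \<in> lshift gk"
    using u1(3) unfolding conc_conc append_assoc .
  ultimately have "(w @ prefix n x @ u1) \<frown> s \<frown> u2 \<frown> s \<frown> u3 \<frown> p \<frown> v \<frown> z \<in> lshift gk"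
    using synchronize by blast
  then have "(w @ (prefix n x @ u1 @ s @ u2 @ s @ u3 @ p) @ v) \<frown> z \<in> lshift gk"
    unfolding conc_conc append_assoc .
  then have "w @ (prefix n x @ u1 @ s @ u2 @ s @ u3 @ p) @ v \<in> lang (lshift gk)"
    unfolding lang_iff using w(1) by blast
  moreover have "length (prefix n x @ u1 @ s @ u2 @ s @ u3 @ p) = 3 * M + 2 * length s + 2 * C + D"
    using u1 u2(1) u3(1) p(1) by simp
  ultimately show ?thesis by blast
qed

end

section \<open>Uniform gaps along the approximating sequence\<close>

text \<open>A periodic tail recurs arbitrarily far out, in particular beyond \<open>\<rho>\<close>,
  where \<open>\<pi>\<close> is a period.\<close>

lemma eventual_period:
  fixes x :: bseq
  shows "\<exists>\<rho> \<pi>. 1 \<le> \<pi> \<and> (\<forall>t. periodic (suffix t x) \<longrightarrow>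
    suffix \<pi> (suffix t x) = suffix t x \<and> periodic (suffix \<rho> x))"
proof (cases "\<exists>t. periodic (suffix t x)")
  case True
  then obtain \<rho> \<pi> where rp: "1 \<le> \<pi>" "suffix \<pi> (suffix \<rho> x) = suffix \<rho> x"
    unfolding periodic_def by blast
  have "suffix \<pi> (suffix t x) = suffix t x" if per: "periodic (suffix t x)" for t
  proof -
    obtain p where p': "1 \<le> p \<and> suffix p (suffix t x) = suffix t x"
      using per unfolding periodic_def ..
    note p = conjunct1[OF p'] conjunct2[OF p']
    have "suffix (0 + \<rho> * p) (suffix t x) = suffix 0 (suffix t x)" by (rule suffix_period_mult[OF p(2)])
    then have eq: "suffix (t + \<rho> * p) x = suffix t x" by simp
    have "\<rho> \<le> t + \<rho> * p" using p(1) by (simp add: trans_le_add2)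
    then obtain m where m: "t + \<rho> * p = \<rho> + m" using le_Suc_ex by blast
    have "suffix \<pi> (suffix (\<rho> + m) x) = suffix m (suffix \<pi> (suffix \<rho> x))"
      by (simp add: add_ac)
    then have "suffix \<pi> (suffix (\<rho> + m) x) = suffix (\<rho> + m) x" unfolding rp(2) by simp
    then show ?thesis using eq m by metis
  qed
  moreover have "periodic (suffix \<rho> x)" using rp unfolding periodic_def by blast
  ultimately show ?thesis using rp(1) by blast
qed auto

lemma common_eventual_period:
  fixes g :: "bool \<Rightarrow> bseq"
  shows "\<exists>\<rho> \<pi>. 1 \<le> \<pi> \<and> (\<forall>t c. periodic (suffix t (g c)) \<longrightarrow>
    suffix \<pi> (suffix t (g c)) = suffix t (g c) \<and> periodic (suffix \<rho> (g c)))"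
proof -
  define ep :: "bool \<Rightarrow> nat \<Rightarrow> nat \<Rightarrow> bool" where "ep c \<rho> \<pi> \<longleftrightarrow> 1 \<le> \<pi> \<and> (\<forall>t. periodic (suffix t (g c)) \<longrightarrow>
    suffix \<pi> (suffix t (g c)) = suffix t (g c) \<and> periodic (suffix \<rho> (g c)))" for c \<rho> \<pi>
  have "\<forall>c. \<exists>\<rho> \<pi>. ep c \<rho> \<pi>" unfolding ep_def using eventual_period by blast
  then obtain \<rho> \<pi> where ep: "\<And>c. ep c (\<rho> c) (\<pi> c)" by metis
  then have rp: "1 \<le> \<pi> c" "periodic (suffix t (g c)) \<Longrightarrow>
      suffix (\<pi> c) (suffix t (g c)) = suffix t (g c) \<and> periodic (suffix (\<rho> c) (g c))" for c t
    unfolding ep_def by blast+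
  have "suffix (\<pi> True * \<pi> False) (suffix t (g c)) = suffix t (g c)" if "periodic (suffix t (g c))" for t c
  proof -
    have "suffix (0 + \<pi> (\<not> c) * \<pi> c) (suffix t (g c)) = suffix 0 (suffix t (g c))"
      by (rule suffix_period_mult[OF conjunct1[OF rp(2)[OF that]]])
    moreover have "0 + \<pi> (\<not> c) * \<pi> c = \<pi> True * \<pi> False" by (cases c) (simp_all add: mult.commute)
    ultimately show ?thesis by simp
  qed
  moreover have "periodic (suffix (\<rho> True + \<rho> False) (g c))" if per: "periodic (suffix t (g c))" for t c
  proof -
    obtain p where p': "1 \<le> p \<and> suffix p (suffix (\<rho> c) (g c)) = suffix (\<rho> c) (g c)"
      using conjunct2[OF rp(2)[OF per]] unfolding periodic_def ..
    note p = conjunct1[OF p'] conjunct2[OF p']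
    have "suffix p (suffix (\<rho> c + m) (g c)) = suffix m (suffix p (suffix (\<rho> c) (g c)))" for m
      by (simp add: add_ac)
    then have "suffix p (suffix (\<rho> c + m) (g c)) = suffix (\<rho> c + m) (g c)" for m
      unfolding p(2) by simp
    then have "periodic (suffix (\<rho> c + m) (g c))" for m using p(1) unfolding periodic_def by (intro exI[of _ p]) simp
    from this[of "\<rho> (\<not> c)"] show ?thesis by (cases c) (simp_all add: add.commute)
  qed
  moreover have "1 \<le> \<pi> True * \<pi> False" using rp(1)[of True] rp(1)[of False] by simp
  ultimately show ?thesis by blast
qed

text \<open>The constants are fixed before \<open>gk\<close>, so that one gap \<open>Q\<close>
  serves all close approximants.\<close>

lemma (in lex_gap) eventually_uniform_gap:
  obtains Q K R where "1 \<le> Q"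
    and "\<And>gk l w v.
      \<lbrakk>\<And>x. x \<in> lshift gk \<longleftrightarrow> x \<in> lshift g \<and>
         (\<forall>c n. \<not> periodic (g c) \<longrightarrow> \<not> agree (l c) (suffix n x) (g c));
       \<And>c. agree K (gk c) (g c); \<And>c. \<not> periodic (g c) \<Longrightarrow> K \<le> l c;
       transitive_shift (lshift gk);
       \<And>w. w \<in> lang (lshift g) \<Longrightarrow> length w \<le> R \<Longrightarrow> w \<in> lang (lshift gk);
       w \<in> lang (lshift gk); v \<in> lang (lshift gk)\<rbrakk>
      \<Longrightarrow> \<exists>u. length u = Q \<and> w @ u @ v \<in> lang (lshift gk)"
proof -
  obtain s where s: "s \<in> lang (lshift g)" "\<And>c. \<not> occurs s (g c)" using synchronizing_word by blast
  obtain \<rho> \<pi> where rp: "1 \<le> \<pi>" "\<And>t c. periodic (suffix t (g c)) \<Longrightarrow>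
    suffix \<pi> (suffix t (g c)) = suffix t (g c) \<and> periodic (suffix \<rho> (g c))"
    using common_eventual_period by metis
  define C where "C = M + length s"
  define D where "D = 2 * C + \<pi> + \<rho> + 1"
  define A where "A = 3 * C + \<rho> + \<pi> * \<pi>"
  define G where "G = (\<Union>c. \<Union>a\<in>{..A}. {suffix a (g c), True ## suffix a (g c), False ## suffix a (g c)})"
  have "finite G" unfolding G_def by auto
  then obtain N0 where N0: "\<forall>x\<in>G. \<forall>y\<in>G. agree N0 x y \<longrightarrow> x = y" using finite_separation by blast
  define N where "N = max 1 N0"
  define K where "K = N + 4 * C + \<rho> + \<pi> + 2"
  show thesis
  proof (rule that)
    show "1 \<le> 3 * M + 2 * length s + 2 * C + D" unfolding D_def by simp
    fix gk :: "bool \<Rightarrow> bseq" and l :: "bool \<Rightarrow> nat" and w v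
    assume appr: "\<And>x. x \<in> lshift gk \<longleftrightarrow> x \<in> lshift g \<and>
         (\<forall>c n. \<not> periodic (g c) \<longrightarrow> \<not> agree (l c) (suffix n x) (g c))"
      and agr: "\<And>c. agree K (gk c) (g c)" and K: "\<And>c. \<not> periodic (g c) \<Longrightarrow> K \<le> l c"
      and trans: "transitive_shift (lshift gk)"
      and words: "\<And>w. w \<in> lang (lshift g) \<Longrightarrow> length w \<le> N + 2 * length s + M + D + 2 * C \<Longrightarrow>
        w \<in> lang (lshift gk)"
      and wv: "w \<in> lang (lshift gk)" "v \<in> lang (lshift gk)"
    have close: "agree N (gk c) (g c)" for c
      by (rule agree_mono[of K]) (use agr in \<open>auto simp: K_def\<close>)
    have sep: "x = y" if "x \<in> G" "y \<in> G" "agree N x y" for x y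
      using N0 that agree_mono unfolding N_def by (meson max.cobounded2)
    have N1: "1 \<le> N" unfolding N_def by simp
    have l_ge: "N + 4 * C + \<rho> + \<pi> + 2 \<le> l c" if "\<not> periodic (g c)" for c
      using K[OF that] unfolding K_def .
    interpret approx_gap g M s N \<rho> \<pi> gk l C D A G
      by unfold_locales (fact C_def D_def A_def G_def s appr close N1 trans sep l_ge words rp)+
    show "\<exists>u. length u = 3 * M + 2 * length s + 2 * C + D \<and> w @ u @ v \<in> lang (lshift gk)"
      using uniform_gap[OF wv] .
  qed
qed

section \<open>Approximants as truncations of the limit shift\<close>

lemma lshift_truncation:
  assumes gk: "\<And>c. gk c \<in> lshift g"
    and per: "\<And>c. periodic (g c) \<Longrightarrow> gk c = g c"
    and nonper: "\<And>c. \<not> periodic (g c) \<Longrightarrow>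
      1 \<le> l c \<and> g c (l c - 1) = c \<and> gk c = (prefix (l c - 1) (g c) @ [\<not> c])\<^sup>\<omega>"
  shows "x \<in> lshift gk \<longleftrightarrow> x \<in> lshift g \<and>
      (\<forall>c n. \<not> periodic (g c) \<longrightarrow> \<not> agree (l c) (suffix n x) (g c))"
proof
  have star: "agree (l c - 1) (gk c) (g c)" "gk c (l c - 1) = (\<not> c)" "suffix (l c) (gk c) = gk c"
    if "\<not> periodic (g c)" for c
  proof -
    have e: "gk c i = (prefix (l c - 1) (g c) @ [\<not> c]) ! (i mod l c)" for i
      using nonper[OF that] by simp
    show "agree (l c - 1) (gk c) (g c)" unfolding agree_def e by (simp add: nth_append)
    show "gk c (l c - 1) = (\<not> c)" using nonper[OF that] unfolding e by (simp add: nth_append)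
    show "suffix (l c) (gk c) = gk c" by (rule ext) (simp add: e)
  qed
  {
    assume x: "x \<in> lshift gk"
    have "x \<in> lshift g"
    proof (rule ccontr)
      assume "x \<notin> lshift g"
      then obtain c n where cn: "dless c (g c) (suffix n x)" by (auto simp: lshift_def)
      moreover have "\<not> dless c (g c) (gk c)" using gk[of c] unfolding lshift_def
        by (metis (mono_tags, lifting) mem_Collect_eq suffix_0)
      ultimately have "dless c (gk c) (suffix n x)" by (rule dless_not_less_trans)
      then show False using x by (auto simp: lshift_def)
    qed
    moreover have "\<not> agree (l c) (suffix n x) (g c)" if np: "\<not> periodic (g c)" for c n
    proof
      assume ag: "agree (l c) (suffix n x) (g c)"
      have "agree (l c - 1) (gk c) (suffix n x)"
        using star(1)[OF np] agree_sym[OF agree_mono[OF ag]] agree_trans by (meson diff_le_self)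
      moreover have "suffix n x (l c - 1) = c"
        using agree_nth[OF ag, of "l c - 1"] nonper[OF np] by auto
      ultimately have "dless c (gk c) (suffix n x)" using star(2)[OF np] by (intro dlessI)
      then show False using x by (auto simp: lshift_def)
    qed
    ultimately show "x \<in> lshift g \<and> (\<forall>c n. \<not> periodic (g c) \<longrightarrow> \<not> agree (l c) (suffix n x) (g c))"
      by blast
  next
    assume x: "x \<in> lshift g \<and> (\<forall>c n. \<not> periodic (g c) \<longrightarrow> \<not> agree (l c) (suffix n x) (g c))"
    have up: "\<not> dless c (g c) (suffix n x)" for c n using x by (auto simp: lshift_def)
    have no: "\<not> (agree d (gk c) (suffix n x) \<and> gk c d = (\<not> c) \<and> x (n + d) = c)"
      if np: "\<not> periodic (g c)" for c d n
    proof (induction d arbitrary: n rule: less_induct)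
      case (less d)
      show ?case
      proof
        assume d: "agree d (gk c) (suffix n x) \<and> gk c d = (\<not> c) \<and> x (n + d) = c"
        define L where "L = l c - 1"
        have l: "l c = Suc L" using nonper[OF np] unfolding L_def by simp
        have s: "agree L (gk c) (g c)" "gk c L = (\<not> c)" "suffix (Suc L) (gk c) = gk c" "g c L = c"
          using star[OF np] nonper[OF np] unfolding L_def[symmetric] l by auto
        consider "d < L" | "d = L" | "L < d" by linarith
        then show False
        proof cases
          case 1
          then have "dless c (g c) (suffix n x)"
            using d s(1) by (intro dlessI[of d]) (auto simp: agree_def)
          then show False using up by blast
        next
          case 2
          then have "agree (Suc L) (suffix n x) (g c)"
            using d s(1,4) by (auto simp: agree_def less_Suc_eq)
          then show False using x np l by metis
        next
          case 3
          have "agree (d - Suc L) (gk c) (suffix (n + Suc L) x)"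
            using agree_suffix[of d "gk c" "suffix n x" "Suc L"] d s(3) by simp
          moreover have "gk c (d - Suc L) = (\<not> c)"
            using d s(3) 3 by (metis Suc_leI le_add_diff_inverse suffix_nth)
          moreover have "x (n + Suc L + (d - Suc L)) = c" using d 3 by simp
          moreover have "d - Suc L < d" using 3 by simp
          ultimately show False using less by blast
        qed
      qed
    qed
    have "\<not> dless c (gk c) (suffix n x)" for c n
    proof (cases "periodic (g c)")
      case True
      then show ?thesis using up per by simp
    next
      case False
      then show ?thesis using no[OF False] unfolding dless_def by auto
    qed
    then show "x \<in> lshift gk" by (auto simp: lshift_def)
  }
qed

section \<open>Translation to the lexicographic definitions\<close>

lemma lex_less_iff_True: "x \<prec> y \<longleftrightarrow> dless True x y"
  and lex_less_iff_False: "x \<prec> y \<longleftrightarrow> dless False y x"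
  unfolding less_fun_def dless_def agree_def by (auto simp: eq_commute)

lemma lex_le_iff: "x \<preceq> y \<longleftrightarrow> \<not> y \<prec> x"
  unfolding lex_le_def lex_less_iff_True
  by (rule dless_cases[where x=x and y=y and c=True]) (auto dest: dless_trans)

definition bounds :: "bseq \<Rightarrow> bseq \<Rightarrow> bool \<Rightarrow> bseq"
  where "bounds \<alpha> \<beta> c = (if c then \<alpha> else \<beta>)"

lemma lex_shift_eq: "lex_shift \<alpha> \<beta> = lshift (bounds \<alpha> \<beta>)"
proof -
  have "(\<forall>c. \<not> dless c (bounds \<alpha> \<beta> c) z) \<longleftrightarrow> \<beta> \<preceq> z \<and> z \<preceq> \<alpha>" for z
    unfolding bounds_def lex_le_iff
    by (auto simp: all_bool_eq lex_less_iff_True[symmetric] lex_less_iff_False[symmetric])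
  then show ?thesis unfolding lex_shift_def lshift_def by blast
qed

text \<open>Shift \<open>0\<close> is settled by the first digits; minimality of
  \<open>\<beta>\<close> among its shifts is the mirror image of maximality in
  \<open>P\<close>.\<close>

lemma LW_in_lex_shift:
  assumes "(\<alpha>, \<beta>) \<in> LW"
  shows "bounds \<alpha> \<beta> c 0 = c" "bounds \<alpha> \<beta> c \<in> lshift (bounds \<alpha> \<beta>)"
proof -
  have a: "\<alpha> 0" "\<not> \<beta> 0" "\<And>n. 1 \<le> n \<Longrightarrow> suffix n \<alpha> \<preceq> \<alpha>" "\<And>n. 1 \<le> n \<Longrightarrow> suffix n (mirror \<beta>) \<preceq> mirror \<beta>"
    "\<And>n. 1 \<le> n \<Longrightarrow> \<beta> \<preceq> suffix n \<alpha> \<and> suffix n \<beta> \<preceq> \<alpha>"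
    using assms unfolding LW_def P_def P_bar_def Sigma1_def Sigma0_def by auto
  have m: "mirror y \<prec> mirror z \<longleftrightarrow> z \<prec> y" for y z
    unfolding mirror_def less_fun_def by auto
  have b: "\<beta> \<preceq> suffix n \<beta>" if "1 \<le> n" for n
  proof -
    have "suffix n (mirror \<beta>) = mirror (suffix n \<beta>)" by (simp add: mirror_def fun_eq_iff)
    then show ?thesis using a(4)[OF that] m unfolding lex_le_iff by metis
  qed
  have "\<beta> \<prec> \<alpha>" using a(1,2) unfolding less_fun_def by (intro exI[of _ 0]) auto
  then have ba: "\<beta> \<preceq> \<alpha>" unfolding lex_le_def by blast
  have refl: "z \<preceq> z" for z unfolding lex_le_def by blast
  have "\<beta> \<preceq> suffix n \<alpha> \<and> suffix n \<alpha> \<preceq> \<alpha>" "\<beta> \<preceq> suffix n \<beta> \<and> suffix n \<beta> \<preceq> \<alpha>" for n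
    using a(3,5)[of n] b[of n] ba refl by (cases "n = 0"; simp)+
  then have "\<alpha> \<in> lex_shift \<alpha> \<beta>" "\<beta> \<in> lex_shift \<alpha> \<beta>"
    unfolding lex_shift_def by blast+
  then show "bounds \<alpha> \<beta> c \<in> lshift (bounds \<alpha> \<beta>)" unfolding lex_shift_eq by (simp add: bounds_def)
  show "bounds \<alpha> \<beta> c 0 = c" using a by (simp add: bounds_def)
qed

lemma B_iff: "w \<in> B n (lshift g) \<longleftrightarrow> length w = n \<and> (\<exists>y. w \<frown> y \<in> lshift g)"
proof (cases "w = []")
  case True
  have "occurs [] x" for x unfolding occurs_iff by simp
  then show ?thesis using True unfolding B_def by auto
next
  case False
  have "w \<in> B n (lshift g) \<longleftrightarrow> length w = n \<and> w \<in> lang (lshift g)"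
    using False unfolding B_def lang_def by (auto simp: Suc_le_eq)
  then show ?thesis using False unfolding lang_iff by blast
qed

text \<open>Words extend on both sides, so a gap for length \<open>Suc n\<close> serves length
  \<open>n\<close>. The gap numbers are thus nondecreasing and their limit exists as a
  supremum.\<close>

lemma specification_number_le:
  assumes tr: "transitive_shift (lex_shift \<alpha> \<beta>)" and Q: "1 \<le> Q"
    and gap: "\<And>w v. w \<in> lang (lex_shift \<alpha> \<beta>) \<Longrightarrow> v \<in> lang (lex_shift \<alpha> \<beta>) \<Longrightarrow>
      \<exists>u. length u = Q \<and> w @ u @ v \<in> lang (lex_shift \<alpha> \<beta>)"
  shows "specification_number \<alpha> \<beta> \<le> enat Q"
proof -
  define h where "h = bounds \<alpha> \<beta>"
  have eq: "lex_shift \<alpha> \<beta> = lshift h" unfolding h_def by (rule lex_shift_eq)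
  define S where "S n = {k. k \<ge> 1 \<and> (\<forall>w\<in>B n (lshift h). \<forall>v\<in>B n (lshift h).
        \<exists>u\<in>B k (lshift h). w @ u @ v \<in> lang (lshift h))}" for n
  have gn: "gap_number \<alpha> \<beta> n = Inf (enat ` S n)" for n unfolding gap_number_def S_def eq ..
  have "S (Suc n) \<subseteq> S n" for n
  proof
    fix k assume k: "k \<in> S (Suc n)"
    have "\<exists>u\<in>B k (lshift h). w @ u @ v \<in> lang (lshift h)"
      if w: "w \<in> B n (lshift h)" and v: "v \<in> B n (lshift h)" for w v
    proof -
      obtain x y where x: "length w = n" "w \<frown> x \<in> lshift h" and y: "length v = n" "v \<frown> y \<in> lshift h"
        using w v unfolding B_iff by blast
      obtain e where "e ## w \<frown> x \<in> lshift h"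
        using transitive_left_extendable[OF tr[unfolded eq] x(2)] by blast
      then have w': "e # w \<in> B (Suc n) (lshift h)" unfolding B_iff using x(1) by auto
      have "v \<frown> y = (v @ [y 0]) \<frown> suffix 1 y" by simp
      then have v': "v @ [y 0] \<in> B (Suc n) (lshift h)" unfolding B_iff using y by (metis length_append_singleton)
      obtain u where u: "u \<in> B k (lshift h)" "(e # w) @ u @ (v @ [y 0]) \<in> lang (lshift h)"
        using k w' v' unfolding S_def by blast
      have "length u = k" using u(1) unfolding B_iff by blast
      \<comment> \<open>For \<open>n = 0\<close> only \<open>k \<ge> 1\<close> keeps the word
        nonempty, as \<open>lang\<close> requires.\<close>
      then have "w @ u @ v \<noteq> []" using k unfolding S_def by auto
      moreover have "[e] @ (w @ u @ v) @ [y 0] \<in> lang (lshift h)" using u(2) by simp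
      ultimately have "w @ u @ v \<in> lang (lshift h)" by (rule lang_appendD[rotated])
      then show ?thesis using u(1) by blast
    qed
    then show "k \<in> S n" using k unfolding S_def by blast
  qed
  then have "gap_number \<alpha> \<beta> n \<le> gap_number \<alpha> \<beta> (Suc n)" for n
    unfolding gn by (intro Inf_superset_mono image_mono)
  then have "incseq (gap_number \<alpha> \<beta>)" by (rule incseq_SucI)
  then have conv: "gap_number \<alpha> \<beta> \<longlonglongrightarrow> (SUP n. gap_number \<alpha> \<beta> n)" by (rule LIMSEQ_SUP)
  then have lim: "specification_number \<alpha> \<beta> = (SUP n. gap_number \<alpha> \<beta> n)"
    unfolding specification_number_def by (rule limI)
  have "gap_number \<alpha> \<beta> n \<le> enat Q" if "1 \<le> n" for n
  proof -
    have "\<exists>u\<in>B Q (lshift h). w @ u @ v \<in> lang (lshift h)"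
      if w: "w \<in> B n (lshift h)" and v: "v \<in> B n (lshift h)" for w v
    proof -
      have "w \<in> lang (lshift h)" "v \<in> lang (lshift h)" using w v \<open>1 \<le> n\<close> unfolding lang_def by auto
      then obtain u where u: "length u = Q" "w @ u @ v \<in> lang (lshift h)" using gap unfolding eq by blast
      have "u \<in> lang (lshift h)" by (rule lang_appendD[OF u(2)]) (use u(1) Q in auto)
      then have "u \<in> B Q (lshift h)" unfolding B_iff lang_iff using u(1) by blast
      then show ?thesis using u(2) by blast
    qed
    then have "Q \<in> S n" unfolding S_def using Q by blast
    then show ?thesis unfolding gn by (intro Inf_lower) simp
  qed
  then show ?thesis unfolding lim[symmetric]
    using conv unfolding lim[symmetric] by (intro Lim_bounded[of _ _ 1]) auto
qed

section \<open>Cylinders and convergence\<close>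

lemma open_agree: "open {y. agree n x y}"
proof -
  have "{y. agree n x y} = (\<Inter>i\<in>{..<n}. (\<lambda>y. y i) -` {x i})"
    by (auto simp: agree_def)
  moreover have "open ((\<lambda>y :: bseq. y i) -` {x i})" for i
    by (rule open_vimage) (auto intro: open_discrete)
  ultimately show ?thesis by (simp add: open_INT)
qed

lemma eventually_agree:
  assumes "f \<longlonglongrightarrow> x" shows "\<forall>\<^sub>F k in sequentially. agree n (f k) x"
  using topological_tendstoD[OF assms open_agree[of n x]] by (auto intro: agree_sym elim: eventually_mono)

text \<open>The cylinder of \<open>w\<close> is open and meets the closure, so it meets some
  approximant and, by monotonicity, all later ones.\<close>

lemma eventually_in_lang:
  assumes cl: "lshift g = closure (\<Union>k. lshift (gs k))"
    and inc: "\<And>k. lshift (gs k) \<subseteq> lshift (gs (Suc k))" and w: "w \<in> lang (lshift g)"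
  shows "\<forall>\<^sub>F k in sequentially. w \<in> lang (lshift (gs k))"
proof -
  obtain y where y: "w \<noteq> []" "w \<frown> y \<in> lshift g" using w unfolding lang_iff by blast
  let ?O = "{x. agree (length w) (w \<frown> y) x}"
  have "w \<frown> y \<in> ?O" by simp
  then have "?O \<inter> closure (\<Union>k. lshift (gs k)) \<noteq> {}" using y(2) unfolding cl[symmetric] by blast
  then have "?O \<inter> (\<Union>k. lshift (gs k)) \<noteq> {}" unfolding open_Int_closure_eq_empty[OF open_agree] .
  then obtain k x where k: "x \<in> lshift (gs k)" "agree (length w) (w \<frown> y) x" by blast
  have "prefix (length w) x = w"
    using k(2) by (intro nth_equalityI) (auto simp: agree_def)
  then have "x = w \<frown> suffix (length w) x" using prefix_suffix[of x "length w"] by metis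
  then have "w \<in> lang (lshift (gs k))" using k(1) y(1) unfolding lang_iff by metis
  moreover have "lshift (gs k) \<subseteq> lshift (gs m)" if "k \<le> m" for m
    using that by (rule lift_Suc_mono_le[of "\<lambda>k. lshift (gs k)", OF inc])
  ultimately show ?thesis unfolding eventually_sequentially lang_iff by blast
qed

text \<open>Treats the cases of the construction bound by bound: \<open>l\<close> is the position,
  counted from 1, of the digit \<open>c\<close> that is flipped to close the period.\<close>

lemma approximating_truncation:
  assumes ap: "approximating_sequence \<alpha> \<beta> \<alpha>s \<beta>s" and np: "\<not> periodic (bounds \<alpha> \<beta> c)"
  shows "\<exists>l\<ge>1. bounds \<alpha> \<beta> c (l - 1) = c \<and>
      bounds (\<alpha>s k) (\<beta>s k) c = (prefix (l - 1) (bounds \<alpha> \<beta> c) @ [\<not> c])\<^sup>\<omega>"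
    and "(\<lambda>k. bounds (\<alpha>s k) (\<beta>s k) c) \<longlonglongrightarrow> bounds \<alpha> \<beta> c"
proof -
  have one: "\<exists>l\<ge>1. \<alpha> (l - 1) \<and> alpha_star \<alpha> (i m) = (prefix (l - 1) \<alpha> @ [False])\<^sup>\<omega>"
    if "one_positions \<alpha> i" for i m
    using that unfolding one_positions_def alpha_star_def
    by (intro exI[of _ "i m"]) (metis One_nat_def Suc_leI less_nat_zero_code not_gr_zero)
  have zero: "\<exists>l\<ge>1. \<not> \<beta> (l - 1) \<and> beta_star \<beta> (j m) = (prefix (l - 1) \<beta> @ [True])\<^sup>\<omega>"
    if "zero_positions \<beta> j" for j m
    using that unfolding zero_positions_def beta_star_def
    by (intro exI[of _ "j m"]) (metis One_nat_def Suc_leI less_nat_zero_code not_gr_zero)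
  have a: "(\<exists>i m. one_positions \<alpha> i \<and> \<alpha>s k = alpha_star \<alpha> (i m)) \<and> \<alpha>s \<longlonglongrightarrow> \<alpha>"
    if "\<not> periodic \<alpha>" for k
    using ap that unfolding approximating_sequence_def by (cases "periodic \<beta>") metis+
  have b: "(\<exists>j m. zero_positions \<beta> j \<and> \<beta>s k = beta_star \<beta> (j m)) \<and> \<beta>s \<longlonglongrightarrow> \<beta>"
    if "\<not> periodic \<beta>" for k
    using ap that unfolding approximating_sequence_def by (cases "periodic \<alpha>") metis+
  show "\<exists>l\<ge>1. bounds \<alpha> \<beta> c (l - 1) = c \<and>
      bounds (\<alpha>s k) (\<beta>s k) c = (prefix (l - 1) (bounds \<alpha> \<beta> c) @ [\<not> c])\<^sup>\<omega>"
  proof (cases c)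
    case True
    then obtain i m where "one_positions \<alpha> i" "\<alpha>s k = alpha_star \<alpha> (i m)"
      using a[of k] np by (auto simp: bounds_def)
    then show ?thesis using one[of i m] True by (simp add: bounds_def)
  next
    case False
    then obtain j m where "zero_positions \<beta> j" "\<beta>s k = beta_star \<beta> (j m)"
      using b[of k] np by (auto simp: bounds_def)
    then show ?thesis using zero[of j m] False by (simp add: bounds_def)
  qed
  show "(\<lambda>k. bounds (\<alpha>s k) (\<beta>s k) c) \<longlonglongrightarrow> bounds \<alpha> \<beta> c"
    using a b np by (cases c) (auto simp: bounds_def)
qed

lemma approximating_periodic:
  assumes "approximating_sequence \<alpha> \<beta> \<alpha>s \<beta>s" "periodic (bounds \<alpha> \<beta> c)"
  shows "bounds (\<alpha>s k) (\<beta>s k) c = bounds \<alpha> \<beta> c"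
proof (cases c)
  case True
  have "periodic \<alpha> \<Longrightarrow> \<alpha>s k = \<alpha>"
    using assms(1) unfolding approximating_sequence_def by (cases "periodic \<beta>") blast+
  then show ?thesis using True assms(2) by (simp add: bounds_def)
next
  case False
  have "periodic \<beta> \<Longrightarrow> \<beta>s k = \<beta>"
    using assms(1) unfolding approximating_sequence_def by (cases "periodic \<alpha>") blast+
  then show ?thesis using False assms(2) by (simp add: bounds_def)
qed

lemma bounded_specification_numbers:
  assumes LW: "(\<alpha>, \<beta>) \<in> LW" and ap: "approximating_sequence \<alpha> \<beta> \<alpha>s \<beta>s"
    and spec: "specification_property (lex_shift \<alpha> \<beta>)"
  shows "\<exists>Q. \<forall>\<^sub>F k in sequentially. specification_number (\<alpha>s k) (\<beta>s k) \<le> enat Q"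
proof -
  define g where "g = bounds \<alpha> \<beta>"
  define gs where "gs k = bounds (\<alpha>s k) (\<beta>s k)" for k
  have X: "lex_shift \<alpha> \<beta> = lshift g" and Xs: "lex_shift (\<alpha>s k) (\<beta>s k) = lshift (gs k)" for k
    unfolding g_def gs_def by (rule lex_shift_eq)+
  have app: "essential (\<alpha>s k) (\<beta>s k) \<and> transitive_shift (lshift (gs k)) \<and> lshift (gs k) \<subseteq> lshift (gs (Suc k))"
    and cl: "lshift g = closure (\<Union>k. lshift (gs k))" for k
    using ap unfolding approximating_sequence_def X Xs by blast+
  \<comment> \<open>By \<open>LW\<close> the bounds of an approximant lie in its own shift, hence in
    the limit shift.\<close>
  have gs_in: "gs k c \<in> lshift g" for k c
  proof -
    have "(\<alpha>s k, \<beta>s k) \<in> LW" using app[of k] unfolding essential_def by blast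
    then have "gs k c \<in> lshift (gs k)" unfolding gs_def by (rule LW_in_lex_shift)
    then have "gs k c \<in> (\<Union>k. lshift (gs k))" by (rule UN_I[OF UNIV_I])
    then show ?thesis unfolding cl by (rule subsetD[OF closure_subset])
  qed
  obtain M where M: "\<forall>w\<in>lang (lshift g). \<forall>v\<in>lang (lshift g).
      \<exists>u\<in>lang (lshift g). length u = M \<and> w @ u @ v \<in> lang (lshift g)"
    using spec unfolding specification_property_def X by blast
  interpret lex_gap g M
  proof
    show "g c 0 = c" "g c \<in> lshift g" for c unfolding g_def by (rule LW_in_lex_shift[OF LW])+
  qed (use M in blast)
  obtain Q K R where Q: "1 \<le> Q"
    and gap: "\<And>gk l w v.
      \<lbrakk>\<And>x. x \<in> lshift gk \<longleftrightarrow> x \<in> lshift g \<and>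
         (\<forall>c n. \<not> periodic (g c) \<longrightarrow> \<not> agree (l c) (suffix n x) (g c));
       \<And>c. agree K (gk c) (g c); \<And>c. \<not> periodic (g c) \<Longrightarrow> K \<le> l c;
       transitive_shift (lshift gk);
       \<And>w. w \<in> lang (lshift g) \<Longrightarrow> length w \<le> R \<Longrightarrow> w \<in> lang (lshift gk);
       w \<in> lang (lshift gk); v \<in> lang (lshift gk)\<rbrakk>
      \<Longrightarrow> \<exists>u. length u = Q \<and> w @ u @ v \<in> lang (lshift gk)"
    by (fact eventually_uniform_gap)
  have per: "gs k c = g c" if "periodic (g c)" for k c
    using approximating_periodic[OF ap] that unfolding g_def gs_def by blast
  have "\<forall>k c. \<exists>l. \<not> periodic (g c) \<longrightarrow>
      1 \<le> l \<and> g c (l - 1) = c \<and> gs k c = (prefix (l - 1) (g c) @ [\<not> c])\<^sup>\<omega>"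
    using approximating_truncation(1)[OF ap] unfolding g_def gs_def by blast
  then obtain l where l: "\<And>k c. \<not> periodic (g c) \<Longrightarrow>
      1 \<le> l k c \<and> g c (l k c - 1) = c \<and> gs k c = (prefix (l k c - 1) (g c) @ [\<not> c])\<^sup>\<omega>"
    by metis
  have "\<forall>\<^sub>F k in sequentially. agree K (gs k c) (g c)" for c
  proof (cases "periodic (g c)")
    case True
    then show ?thesis using per by simp
  next
    case False
    have "(\<lambda>k. gs k c) \<longlonglongrightarrow> g c"
      using approximating_truncation(2)[OF ap, of c] False unfolding g_def gs_def by blast
    then show ?thesis by (rule eventually_agree)
  qed
  then have ev1: "\<forall>\<^sub>F k in sequentially. \<forall>c\<in>UNIV. agree K (gs k c) (g c)"
    by (intro eventually_ball_finite) auto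
  define W where "W = {w \<in> lang (lshift g). length w \<le> R}"
  have "finite {w :: bword. set w \<subseteq> UNIV \<and> length w \<le> R}" by (rule finite_lists_length_le) simp
  then have "finite W" by (rule rev_finite_subset) (auto simp: W_def)
  then have ev2: "\<forall>\<^sub>F k in sequentially. \<forall>w\<in>W. w \<in> lang (lshift (gs k))"
  proof (rule eventually_ball_finite, intro ballI)
    fix w assume "w \<in> W"
    then have "w \<in> lang (lshift g)" unfolding W_def by blast
    then show "\<forall>\<^sub>F k in sequentially. w \<in> lang (lshift (gs k))"
      using app by (intro eventually_in_lang[OF cl]) blast+
  qed
  have "\<forall>\<^sub>F k in sequentially. specification_number (\<alpha>s k) (\<beta>s k) \<le> enat Q"
    using ev1 ev2
  proof eventually_elim
    case (elim k)
    \<comment> \<open>\<open>gs k c\<close> and \<open>g c\<close> differ at digit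
      \<open>l k c - 1\<close>, so agreement on \<open>K\<close> digits makes the forbidden prefix
      long.\<close>
    have "K \<le> l k c" if np: "\<not> periodic (g c)" for c
    proof (rule ccontr)
      assume less: "\<not> K \<le> l k c"
      have "gs k c (l k c - 1) = (\<not> c)"
        using l[OF np, of k] by (simp add: nth_append)
      moreover have "gs k c (l k c - 1) = g c (l k c - 1)"
        using elim(1) less agree_nth[of K "gs k c" "g c" "l k c - 1"] by simp
      ultimately show False using l[OF np, of k] by simp
    qed
    moreover have "x \<in> lshift (gs k) \<longleftrightarrow> x \<in> lshift g \<and>
      (\<forall>c n. \<not> periodic (g c) \<longrightarrow> \<not> agree (l k c) (suffix n x) (g c))" for x
      using gs_in per l by (rule lshift_truncation)
    ultimately have "\<exists>u. length u = Q \<and> w @ u @ v \<in> lang (lshift (gs k))"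
      if "w \<in> lang (lshift (gs k))" "v \<in> lang (lshift (gs k))" for w v
      using that elim app[of k] by (intro gap[of "gs k" "l k"]) (auto simp: W_def)
    then show ?case
      using app[of k] Q by (intro specification_number_le) (auto simp: Xs)
  qed
  then show ?thesis by blast
qed

theorem theorem6p4:
  fixes \<alpha> \<beta> :: bseq and \<alpha>s \<beta>s :: "nat \<Rightarrow> bseq"
  assumes "(\<alpha>, \<beta>) \<in> LW"
    and "\<not> renormalisable \<alpha> \<beta>"
    and "coded \<alpha> \<beta>"
    and "approximating_sequence \<alpha> \<beta> \<alpha>s \<beta>s"
    and "\<exists>n :: nat \<Rightarrow> nat. strict_mono n \<and>
      (\<forall>k. length (p1 (\<alpha>s (n k)) (\<beta>s (n k)) @ p2 (\<alpha>s (n k)) (\<beta>s (n k)))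
             < length (p1 (\<alpha>s (n (Suc k))) (\<beta>s (n (Suc k))) @ p2 (\<alpha>s (n (Suc k))) (\<beta>s (n (Suc k)))) \<and>
           enat (length (p1 (\<alpha>s (n k)) (\<beta>s (n k)) @ p2 (\<alpha>s (n k)) (\<beta>s (n k))))
             \<le> specification_number (\<alpha>s (n (Suc k))) (\<beta>s (n (Suc k))))"
  shows "\<not> specification_property (lex_shift \<alpha> \<beta>)"
proof
  assume spec: "specification_property (lex_shift \<alpha> \<beta>)"
  define p where "p k = length (p1 (\<alpha>s k) (\<beta>s k) @ p2 (\<alpha>s k) (\<beta>s k))" for k
  obtain n :: "nat \<Rightarrow> nat" where n: "strict_mono n" "\<And>k. p (n k) < p (n (Suc k))"
    "\<And>k. enat (p (n k)) \<le> specification_number (\<alpha>s (n (Suc k))) (\<beta>s (n (Suc k)))"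
    using assms(5) unfolding p_def by blast
  obtain Q K where Q: "\<And>k. K \<le> k \<Longrightarrow> specification_number (\<alpha>s k) (\<beta>s k) \<le> enat Q"
    using bounded_specification_numbers[OF assms(1,4) spec] unfolding eventually_sequentially by blast
  have "strict_mono (p \<circ> n)" using n(2) by (simp add: strict_mono_Suc_iff)
  \<comment> \<open>The index \<open>K + Suc Q\<close> pushes the length past \<open>Q\<close> and
    the next approximant past \<open>K\<close>.\<close>
  then have "K + Suc Q \<le> p (n (K + Suc Q))" using strict_mono_imp_increasing[of "p \<circ> n"] by simp
  moreover have "K \<le> n (Suc (K + Suc Q))"
    using strict_mono_imp_increasing[OF n(1), of "Suc (K + Suc Q)"] by simp
  then have "enat (p (n (K + Suc Q))) \<le> enat Q" using n(3) Q order_trans by blast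
  ultimately show False by simp
qed

end
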